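(* Let $CC$ be a C-system, let $\Pi:\mathcal{O}b_2\to\mathcal{O}b_1$ be a morphism of presheaves on $CC$, and let $\mathbf{\Pi}:Ob_{\ge2}\to Ob$ be the function $\mathbf{\Pi}(B)=\Pi_{ft^2(B)}(B)$. There is a bijection between the sets $All\lambda_2^{\Pi}$ and $AllAp_2^{\mathbf{\Pi}}$. Explicitly, the following two functions are well defined and mutually inverse: (i) $C1:All\lambda_2^{\Pi}\to AllAp_2^{\mathbf{\Pi}}$ sends $\lambda_{*,*}$ to the family $Ap_*$ with, for $B\in Ob_{\ge 2}$, $\Gamma=ft^2(B)$ and $P=\mathbf{\Pi}(B)$, $$Ap_B=(\lambda_{P,\,P\times_{\Gamma}B})^{-1}(\delta)\circ q(p_{P},B),$$ where $\delta:P\to P\times_{\Gamma}P=\mathbf{\Pi}(P\times_{\Gamma}B)$ is the diagonal, i.e. the unique morphism with $\delta\circ p_{P\times_{\Gamma}P}=Id_P$ and $\delta\circ q(p_P,P)=Id_P$; (ii) $C2:AllAp_2^{\mathbf{\Pi}}\to All\lambda_2^{\Pi}$ sends $Ap_*$ to the double family $\lambda_{\Gamma,B}=(\lambda\mathrm{inv}_B)^{-1}$, where $\lambda\mathrm{inv}_B:\partial^{-1}(\mathbf{\Pi}(B))\to\partial^{-1}(B)$ is $\lambda\mathrm{inv}_B(s)=q(s,\mathbf{\Pi}(B)\times_{\Gamma}ft(B))\circ Ap_B$.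
   Context: Composition is written in diagrammatic order: for $f:X\to Y$, $g:Y\to Z$, the composite is $f\circ g:X\to Z$. A C-system $CC$ consists of a category with set of objects $Ob$ and set of morphisms $Mor$, functions $l:Ob\to\mathbb{N}$ and $ft:Ob\to Ob$, an object $pt$, for each $X$ a morphism $p_X:X\to ft(X)$, and for each $X$ with $l(X)>0$ and each $f:Y\to ft(X)$ an object $f^*(X)$ and a morphism $q(f,X):f^*(X)\to X$, such that: $l^{-1}(0)=\{pt\}$; $l(ft(X))=l(X)-1$ if $l(X)>0$; $ft(pt)=pt$; $pt$ is a final object; if $l(X)>0$ and $f:Y\to ft(X)$, then $l(f^*(X))>0$, $ft(f^*(X))=Y$, $p_{f^*(X)}\circ f=q(f,X)\circ p_X$ and this square is a pullback; $Id_{ft(X)}^*(X)=X$ and $q(Id_{ft(X)},X)=Id_X$; for $g:Z\to Y$ and $f:Y\to ft(X)$, $(g\circ f)^*(X)=g^*(f^*(X))$ and $q(g\circ f,X)=q(g,f^*(X))\circ q(f,X)$. $X\ge Y$ ("$X$ is over $Y$") means $l(X)\ge l(Y)$ and $Y=ft^{l(X)-l(Y)}(X)$; $X>Y$ means $X\ge Y$ and $l(X)>l(Y)$. For $X\ge Y$, $p(X,Y):X\to Y$ is defined by $p(X,X)=Id_X$, $p(X,Y)=p_X\circ p(ft(X),Y)$ if $X>Y$. For $X\ge\Gamma$ and $f:\Gamma'\to\Gamma$, $f^*(X)$ and $q(f,X):f^*(X)\to X$ are defined recursively by $f^*(\Gamma)=\Gamma'$, $q(f,\Gamma)=f$, and,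 for $X>\Gamma$, $f^*(X)=q(f,ft(X))^*(X)$, $q(f,X)=q(q(f,ft(X)),X)$. For $X,Y\ge\Gamma$, $X\times_{\Gamma}Y=p(X,\Gamma)^*(Y)$ (a fiber product with projections $p(X\times_\Gamma Y,X)$ and $q(p(X,\Gamma),Y)$). A morphism $a:X\to Y$ is a morphism over $\Gamma$ if $X,Y\ge\Gamma$ and $a\circ p(Y,\Gamma)=p(X,\Gamma)$. For such $a$ and $f:\Gamma'\to\Gamma$, $f^*(a):f^*(X)\to f^*(Y)$ is the unique morphism over $\Gamma'$ with $f^*(a)\circ q(f,Y)=q(f,X)\circ a$. For $p:X\to Y$, $sec(p)=\{s:Y\to X\mid s\circ p=Id_Y\}$. $\mathcal{O}b_n$ is the presheaf $\mathcal{O}b_n(\Gamma)=\{X\mid l(X)=l(\Gamma)+n,\ ft^n(X)=\Gamma\}$ with restriction along $f$ given by $f^*$. $\widetilde{\mathcal{O}b}=\{o\in Mor\mid o\in sec(p_{codom(o)}),\ codom(o)>pt\}$ and $\partial:\widetilde{\mathcal{O}b}\to Ob$, $\partial(o)=codom(o)$; so $\partial^{-1}(X)$ is the set of sections of $p_X$ for $l(X)>0$. $Ob_{\ge 2}=\{B\mid l(B)\ge2\}$; for $B\in Ob_{\ge2}$ write $A=ft(B)$, $\Gamma=ft^2(B)$. $All\lambda_2^{\Pi}$ is the set of double families of bijections $\lambda_{\Gamma,B}:\partial^{-1}(B)\to\partial^{-1}(\Pi_{\Gamma}(B))$, parametrized by $\Gamma\in Ob$ and $B\in\mathcal{O}b_2(\Gamma)$,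 such that for every $f:\Gamma'\to\Gamma$, $B\in\mathcal{O}b_2(\Gamma)$ and $o\in\partial^{-1}(B)$ one has $f^*(\lambda_{\Gamma,B}(o))=\lambda_{\Gamma',f^*(B)}(f^*(o))$. The function $\mathbf{\Pi}$ satisfies: $ft(\mathbf{\Pi}(B))=\Gamma$, and $f^*(\mathbf{\Pi}(B))=\mathbf{\Pi}(f^*(B))$ for all $f:\Gamma'\to\Gamma$. $AllAp_2^{\mathbf{\Pi}}$ is the set of families of morphisms $Ap_B:\mathbf{\Pi}(B)\times_{\Gamma}A\to B$ parametrized by $B\in Ob_{\ge2}$ such that: (a) $Ap_B\circ p_B=q(p_{\mathbf{\Pi}(B)},A)$; (b) $f^*(Ap_B)=Ap_{f^*(B)}$ for every $f:\Gamma'\to\Gamma$ (by (a), $Ap_B$ is a morphism over $\Gamma$); (c) the function $\partial^{-1}(\mathbf{\Pi}(B))\to\partial^{-1}(B)$, $s\mapsto q(s,\mathbf{\Pi}(B)\times_{\Gamma}A)\circ Ap_B$, is a bijection. *)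

theory Defs
  imports "HOL-Library.FuncSet"
begin

(* Composition is diagrammatic: Comp f g (written f \<odot> g) is "first f, then g".
   pb1 f X and q1 f X are the primitive operations f^*(X) and q(f, X), meaningful
   only for f with codomain ft X and len X > 0; their extensions to all X over
   the codomain of f are pull and qm below. *)
record ('o, 'm) csys =
  Ob :: "'o set"
  Mor :: "'m set"
  Dom :: "'m \<Rightarrow> 'o"
  Cod :: "'m \<Rightarrow> 'o"
  Ident :: "'o \<Rightarrow> 'm"
  Comp :: "'m \<Rightarrow> 'm \<Rightarrow> 'm" (infixl "\<odot>\<index>" 70)
  len :: "'o \<Rightarrow> nat"
  ft :: "'o \<Rightarrow> 'o"
  pt :: 'o
  pr :: "'o \<Rightarrow> 'm"
  pb1 :: "'m \<Rightarrow> 'o \<Rightarrow> 'o"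
  q1 :: "'m \<Rightarrow> 'o \<Rightarrow> 'm"

definition hom :: "('o, 'm) csys \<Rightarrow> 'o \<Rightarrow> 'o \<Rightarrow> 'm set" where
  "hom CC X Y = {f \<in> Mor CC. Dom CC f = X \<and> Cod CC f = Y}"

(* The square  W --v--> X,  W --u--> Y,  Y --f--> Z,  X --g--> Z. *)
definition is_pullback ::
    "('o, 'm) csys \<Rightarrow> 'm \<Rightarrow> 'm \<Rightarrow> 'm \<Rightarrow> 'm \<Rightarrow> bool" where
  "is_pullback CC u v f g \<longleftrightarrow>
     u \<in> hom CC (Dom CC v) (Dom CC f) \<and> v \<in> hom CC (Dom CC u) (Dom CC g) \<and>
     f \<in> hom CC (Dom CC f) (Cod CC g) \<and> g \<in> hom CC (Dom CC g) (Cod CC f) \<and>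
     u \<odot>\<^bsub>CC\<^esub> f = v \<odot>\<^bsub>CC\<^esub> g \<and>
     (\<forall>T\<in>Ob CC. \<forall>a\<in>hom CC T (Dom CC f). \<forall>b\<in>hom CC T (Dom CC g).
        a \<odot>\<^bsub>CC\<^esub> f = b \<odot>\<^bsub>CC\<^esub> g \<longrightarrow>
        (\<exists>!w. w \<in> hom CC T (Dom CC u) \<and> w \<odot>\<^bsub>CC\<^esub> u = a \<and> w \<odot>\<^bsub>CC\<^esub> v = b))"

locale category =
  fixes CC :: "('o, 'm) csys" (structure)
  assumes Dom_closed: "f \<in> Mor CC \<Longrightarrow> Dom CC f \<in> Ob CC"
    and Cod_closed: "f \<in> Mor CC \<Longrightarrow> Cod CC f \<in> Ob CC"
    and Ident_hom: "X \<in> Ob CC \<Longrightarrow> Ident CC X \<in> hom CC X X"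
    and Comp_hom: "f \<in> hom CC X Y \<Longrightarrow> g \<in> hom CC Y Z \<Longrightarrow> f \<odot> g \<in> hom CC X Z"
    and Ident_left: "f \<in> hom CC X Y \<Longrightarrow> Ident CC X \<odot> f = f"
    and Ident_right: "f \<in> hom CC X Y \<Longrightarrow> f \<odot> Ident CC Y = f"
    and Comp_assoc: "f \<in> hom CC X Y \<Longrightarrow> g \<in> hom CC Y Z \<Longrightarrow> h \<in> hom CC Z W \<Longrightarrow>
      (f \<odot> g) \<odot> h = f \<odot> (g \<odot> h)"

locale C_system = category +
  assumes ft_closed: "X \<in> Ob CC \<Longrightarrow> ft CC X \<in> Ob CC"
    and pr_hom: "X \<in> Ob CC \<Longrightarrow> pr CC X \<in> hom CC X (ft CC X)"
    and pb1_closed: "X \<in> Ob CC \<Longrightarrow> len CC X > 0 \<Longrightarrow> f \<in> hom CC Y (ft CC X) \<Longrightarrow>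
      pb1 CC f X \<in> Ob CC"
    and q1_hom: "X \<in> Ob CC \<Longrightarrow> len CC X > 0 \<Longrightarrow> f \<in> hom CC Y (ft CC X) \<Longrightarrow>
      q1 CC f X \<in> hom CC (pb1 CC f X) X"
    and len_eq_0: "{X \<in> Ob CC. len CC X = 0} = {pt CC}"
    and len_ft: "X \<in> Ob CC \<Longrightarrow> len CC X > 0 \<Longrightarrow> len CC (ft CC X) = len CC X - 1"
    and ft_pt: "ft CC (pt CC) = pt CC"
    and pt_final: "X \<in> Ob CC \<Longrightarrow> \<exists>!f. f \<in> hom CC X (pt CC)"
    and len_pb1: "X \<in> Ob CC \<Longrightarrow> len CC X > 0 \<Longrightarrow> f \<in> hom CC Y (ft CC X) \<Longrightarrow>
      len CC (pb1 CC f X) > 0"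
    and ft_pb1: "X \<in> Ob CC \<Longrightarrow> len CC X > 0 \<Longrightarrow> f \<in> hom CC Y (ft CC X) \<Longrightarrow>
      ft CC (pb1 CC f X) = Y"
    and pb1_pullback: "X \<in> Ob CC \<Longrightarrow> len CC X > 0 \<Longrightarrow> f \<in> hom CC Y (ft CC X) \<Longrightarrow>
      is_pullback CC (pr CC (pb1 CC f X)) (q1 CC f X) f (pr CC X)"
    and pb1_Ident: "X \<in> Ob CC \<Longrightarrow> len CC X > 0 \<Longrightarrow> pb1 CC (Ident CC (ft CC X)) X = X"
    and q1_Ident: "X \<in> Ob CC \<Longrightarrow> len CC X > 0 \<Longrightarrow>
      q1 CC (Ident CC (ft CC X)) X = Ident CC X"
    and pb1_Comp: "X \<in> Ob CC \<Longrightarrow> len CC X > 0 \<Longrightarrow> g \<in> hom CC Z Y \<Longrightarrow>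
      f \<in> hom CC Y (ft CC X) \<Longrightarrow> pb1 CC (g \<odot> f) X = pb1 CC g (pb1 CC f X)"
    and q1_Comp: "X \<in> Ob CC \<Longrightarrow> len CC X > 0 \<Longrightarrow> g \<in> hom CC Z Y \<Longrightarrow>
      f \<in> hom CC Y (ft CC X) \<Longrightarrow> q1 CC (g \<odot> f) X = q1 CC g (pb1 CC f X) \<odot> q1 CC f X"

definition over :: "('o, 'm) csys \<Rightarrow> 'o \<Rightarrow> 'o \<Rightarrow> bool" where
  "over CC X Y \<longleftrightarrow> len CC Y \<le> len CC X \<and> Y = (ft CC ^^ (len CC X - len CC Y)) X"

definition strictly_over :: "('o, 'm) csys \<Rightarrow> 'o \<Rightarrow> 'o \<Rightarrow> bool" where
  "strictly_over CC X Y \<longleftrightarrow> over CC X Y \<and> len CC Y < len CC X"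

(* The recursions for p(X, Y), f^*(X) and q(f, X), driven by the difference n of lengths. *)
primrec proj_rec :: "('o, 'm) csys \<Rightarrow> nat \<Rightarrow> 'o \<Rightarrow> 'm" where
  "proj_rec CC 0 X = Ident CC X"
| "proj_rec CC (Suc n) X = pr CC X \<odot>\<^bsub>CC\<^esub> proj_rec CC n (ft CC X)"

primrec qm_rec :: "('o, 'm) csys \<Rightarrow> nat \<Rightarrow> 'm \<Rightarrow> 'o \<Rightarrow> 'm" where
  "qm_rec CC 0 f X = f"
| "qm_rec CC (Suc n) f X = q1 CC (qm_rec CC n f (ft CC X)) X"

primrec pull_rec :: "('o, 'm) csys \<Rightarrow> nat \<Rightarrow> 'm \<Rightarrow> 'o \<Rightarrow> 'o" where
  "pull_rec CC 0 f X = Dom CC f"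
| "pull_rec CC (Suc n) f X = pb1 CC (qm_rec CC n f (ft CC X)) X"

(* p(X, Y) for X over Y *)
definition proj :: "('o, 'm) csys \<Rightarrow> 'o \<Rightarrow> 'o \<Rightarrow> 'm" where
  "proj CC X Y = proj_rec CC (len CC X - len CC Y) X"

(* f^*(X) and q(f, X) for X over the codomain of f *)
definition pull :: "('o, 'm) csys \<Rightarrow> 'm \<Rightarrow> 'o \<Rightarrow> 'o" where
  "pull CC f X = pull_rec CC (len CC X - len CC (Cod CC f)) f X"

definition qm :: "('o, 'm) csys \<Rightarrow> 'm \<Rightarrow> 'o \<Rightarrow> 'm" where
  "qm CC f X = qm_rec CC (len CC X - len CC (Cod CC f)) f X"

(* The fiber product of X and Y over G *)
definition fprod :: "('o, 'm) csys \<Rightarrow> 'o \<Rightarrow> 'o \<Rightarrow> 'o \<Rightarrow> 'o" where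
  "fprod CC G X Y = pull CC (proj CC X G) Y"

definition mor_over :: "('o, 'm) csys \<Rightarrow> 'o \<Rightarrow> 'm \<Rightarrow> bool" where
  "mor_over CC G a \<longleftrightarrow> a \<in> Mor CC \<and> over CC (Dom CC a) G \<and> over CC (Cod CC a) G \<and>
     a \<odot>\<^bsub>CC\<^esub> proj CC (Cod CC a) G = proj CC (Dom CC a) G"

(* f^*(a) for a morphism a over the codomain of f *)
definition pull_mor :: "('o, 'm) csys \<Rightarrow> 'm \<Rightarrow> 'm \<Rightarrow> 'm" where
  "pull_mor CC f a = (THE b.
     b \<in> hom CC (pull CC f (Dom CC a)) (pull CC f (Cod CC a)) \<and> mor_over CC (Dom CC f) b \<and>
     b \<odot>\<^bsub>CC\<^esub> qm CC f (Cod CC a) = qm CC f (Dom CC a) \<odot>\<^bsub>CC\<^esub> a)"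

definition sec :: "('o, 'm) csys \<Rightarrow> 'm \<Rightarrow> 'm set" where
  "sec CC p = {s \<in> hom CC (Cod CC p) (Dom CC p). s \<odot>\<^bsub>CC\<^esub> p = Ident CC (Cod CC p)}"

definition Ob_n :: "('o, 'm) csys \<Rightarrow> nat \<Rightarrow> 'o \<Rightarrow> 'o set" where
  "Ob_n CC n G = {X \<in> Ob CC. len CC X = len CC G + n \<and> (ft CC ^^ n) X = G}"

definition Ob_ge2 :: "('o, 'm) csys \<Rightarrow> 'o set" where
  "Ob_ge2 CC = {B \<in> Ob CC. 2 \<le> len CC B}"

definition Ob_tilde :: "('o, 'm) csys \<Rightarrow> 'm set" where
  "Ob_tilde CC = {s \<in> Mor CC. s \<in> sec CC (pr CC (Cod CC s)) \<and> strictly_over CC (Cod CC s) (pt CC)}"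

(* The fiber over X of the map from Ob_tilde to Ob sending s to its codomain *)
definition del_fiber :: "('o, 'm) csys \<Rightarrow> 'o \<Rightarrow> 'm set" where
  "del_fiber CC X = {s \<in> Ob_tilde CC. Cod CC s = X}"

(* A presheaf is given by its sets of sections F, F' and its restriction maps r, r'. *)
definition presheaf_morphism ::
    "('o, 'm) csys \<Rightarrow> ('o \<Rightarrow> 'a set) \<Rightarrow> ('m \<Rightarrow> 'a \<Rightarrow> 'a) \<Rightarrow>
     ('o \<Rightarrow> 'b set) \<Rightarrow> ('m \<Rightarrow> 'b \<Rightarrow> 'b) \<Rightarrow> ('o \<Rightarrow> 'a \<Rightarrow> 'b) \<Rightarrow> bool" where
  "presheaf_morphism CC F r F' r' \<phi> \<longleftrightarrow>
     (\<forall>G\<in>Ob CC. \<phi> G \<in> F G \<rightarrow> F' G) \<and>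
     (\<forall>f\<in>Mor CC. \<forall>x\<in>F (Cod CC f). r' f (\<phi> (Cod CC f) x) = \<phi> (Dom CC f) (r f x))"

(* The function on Ob_ge2 given by a family P indexed by G and B in Ob_n 2 G *)
definition bold :: "('o, 'm) csys \<Rightarrow> ('o \<Rightarrow> 'o \<Rightarrow> 'o) \<Rightarrow> 'o \<Rightarrow> 'o" where
  "bold CC P B = P ((ft CC ^^ 2) B) B"

(* Families of functions and of morphisms are extensional (PiE), so that equality of
   elements of All_lambda2 and All_Ap2 is equality of families on their index sets. *)
definition All_lambda2 :: "('o, 'm) csys \<Rightarrow> ('o \<Rightarrow> 'o \<Rightarrow> 'o) \<Rightarrow> ('o \<Rightarrow> 'o \<Rightarrow> 'm \<Rightarrow> 'm) set" where
  "All_lambda2 CC P = {lam \<in> (\<Pi>\<^sub>E G\<in>Ob CC. \<Pi>\<^sub>E B\<in>Ob_n CC 2 G. del_fiber CC B \<rightarrow>\<^sub>E del_fiber CC (P G B)).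
     (\<forall>G\<in>Ob CC. \<forall>B\<in>Ob_n CC 2 G. bij_betw (lam G B) (del_fiber CC B) (del_fiber CC (P G B))) \<and>
     (\<forall>f\<in>Mor CC. \<forall>B\<in>Ob_n CC 2 (Cod CC f). \<forall>s\<in>del_fiber CC B.
        pull_mor CC f (lam (Cod CC f) B s) = lam (Dom CC f) (pull CC f B) (pull_mor CC f s))}"

definition lambda_inv :: "('o, 'm) csys \<Rightarrow> ('o \<Rightarrow> 'o) \<Rightarrow> ('o \<Rightarrow> 'm) \<Rightarrow> 'o \<Rightarrow> 'm \<Rightarrow> 'm" where
  "lambda_inv CC PP Ap B s =
     qm CC s (fprod CC ((ft CC ^^ 2) B) (PP B) (ft CC B)) \<odot>\<^bsub>CC\<^esub> Ap B"

definition All_Ap2 :: "('o, 'm) csys \<Rightarrow> ('o \<Rightarrow> 'o) \<Rightarrow> ('o \<Rightarrow> 'm) set" where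
  "All_Ap2 CC PP =
     {Ap \<in> (\<Pi>\<^sub>E B\<in>Ob_ge2 CC. hom CC (fprod CC ((ft CC ^^ 2) B) (PP B) (ft CC B)) B).
     (\<forall>B\<in>Ob_ge2 CC. Ap B \<odot>\<^bsub>CC\<^esub> pr CC B = qm CC (pr CC (PP B)) (ft CC B)) \<and>
     (\<forall>B\<in>Ob_ge2 CC. \<forall>f\<in>Mor CC. Cod CC f = (ft CC ^^ 2) B \<longrightarrow>
        pull_mor CC f (Ap B) = Ap (pull CC f B)) \<and>
     (\<forall>B\<in>Ob_ge2 CC. bij_betw (lambda_inv CC PP Ap B) (del_fiber CC (PP B)) (del_fiber CC B))}"

definition is_diagonal :: "('o, 'm) csys \<Rightarrow> 'o \<Rightarrow> 'o \<Rightarrow> 'm \<Rightarrow> bool" where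
  "is_diagonal CC G X d \<longleftrightarrow> d \<in> hom CC X (fprod CC G X X) \<and>
     d \<odot>\<^bsub>CC\<^esub> pr CC (fprod CC G X X) = Ident CC X \<and>
     d \<odot>\<^bsub>CC\<^esub> qm CC (pr CC X) X = Ident CC X"

definition diagonal :: "('o, 'm) csys \<Rightarrow> 'o \<Rightarrow> 'o \<Rightarrow> 'm" where
  "diagonal CC G X = (THE d. is_diagonal CC G X d)"

definition C1 :: "('o, 'm) csys \<Rightarrow> ('o \<Rightarrow> 'o \<Rightarrow> 'o) \<Rightarrow> ('o \<Rightarrow> 'o \<Rightarrow> 'm \<Rightarrow> 'm) \<Rightarrow> 'o \<Rightarrow> 'm" where
  "C1 CC P lam = (\<lambda>B\<in>Ob_ge2 CC.
     let G = (ft CC ^^ 2) B; Q = bold CC P B; QB = fprod CC G Q B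
     in inv_into (del_fiber CC QB) (lam Q QB) (diagonal CC G Q) \<odot>\<^bsub>CC\<^esub> qm CC (pr CC Q) B)"

definition C2 :: "('o, 'm) csys \<Rightarrow> ('o \<Rightarrow> 'o \<Rightarrow> 'o) \<Rightarrow> ('o \<Rightarrow> 'm) \<Rightarrow> 'o \<Rightarrow> 'o \<Rightarrow> 'm \<Rightarrow> 'm" where
  "C2 CC P Ap = (\<lambda>G\<in>Ob CC. \<lambda>B\<in>Ob_n CC 2 G. \<lambda>s\<in>del_fiber CC B.
     inv_into (del_fiber CC (bold CC P B)) (lambda_inv CC (bold CC P) Ap B) s)"

end

theory Submission
  imports Defs
begin

text \<open>
  The diagonal \<open>\<delta>\<close> of \<open>Q = \<Pi>(B)\<close> is the generic section of \<open>p\<^sub>Q\<close>: every section \<open>s\<close> is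
  \<open>s\<^sup>*(\<delta>)\<close> (\<open>pull_sec_diagonal\<close>), and the diagonals are stable under base change
  (\<open>pull_qm_diagonal\<close>). A natural family of bijections \<open>\<lambda>\<close> is therefore determined by the
  sections \<open>e = \<lambda>\<^sup>-\<^sup>1(\<delta>)\<close> of \<open>Q \<times> B \<rightarrow> Q \<times> A\<close>, where \<open>A = ft(B)\<close>; such a section is the same
  thing as a morphism \<open>Ap : Q \<times> A \<rightarrow> B\<close> over \<open>A\<close>, namely \<open>e\<close> followed by the projection to \<open>B\<close>.
  This is a form of the Yoneda lemma.

  Concretely, for \<open>Ap\<close> obtained from \<open>\<lambda>\<close>, functoriality of \<open>q\<close> gives
  \<open>\<lambda>inv(s) = q(s, Q \<times> A) \<odot> e \<odot> q(p\<^sub>Q, B) = s\<^sup>*(e)\<close>, and naturality gives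
  \<open>\<lambda>(s\<^sup>*(e)) = s\<^sup>*(\<lambda>(e)) = s\<^sup>*(\<delta>) = s\<close>; so \<open>\<lambda>inv\<close> is inverse to \<open>\<lambda>\<close>
  (\<open>lambda_lambda_inv_C1\<close>), which proves both that \<open>\<lambda>inv\<close> is bijective and that the round
  trip from \<open>\<lambda>\<close> is the identity. Stability of \<open>Ap\<close> along \<open>f\<close> is naturality of \<open>\<lambda>\<close> along
  \<open>q(f, Q)\<close> (\<open>C1_qm\<close>). Conversely, stability of a given \<open>Ap\<close> makes \<open>\<lambda>inv\<close> natural
  (\<open>lambda_inv_pull\<close>), and stability along \<open>p\<^sub>Q\<close> together with \<open>\<delta> \<odot> q(p\<^sub>Q, Q) = Id\<close> recovers
  \<open>Ap\<close> as \<open>\<lambda>inv(\<delta>) \<odot> q(p\<^sub>Q, B)\<close> (\<open>C1_C2\<close>).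

  All this rests on the strict laws for the iterated operations \<open>f\<^sup>*(X)\<close> and \<open>q(f, X)\<close>:
  functoriality in \<open>f\<close>, pulling back in stages, and the cartesian square over the
  iterated projection. They are proved by induction on the number of levels between \<open>X\<close>
  and the codomain of \<open>f\<close>, that is, for \<open>X \<in> Ob_n CC n G\<close>.
\<close>

section \<open>Iterated canonical pullbacks\<close>

context category
begin

lemma hom_Dom: "f \<in> hom CC X Y \<Longrightarrow> Dom CC f = X"
  and hom_Cod: "f \<in> hom CC X Y \<Longrightarrow> Cod CC f = Y"
  by (auto simp: hom_def)

lemma hom_Ob:
  assumes "f \<in> hom CC X Y"
  shows "X \<in> Ob CC" "Y \<in> Ob CC"
  using assms Dom_closed Cod_closed by (auto simp: hom_def)

lemma Mor_hom: "f \<in> Mor CC \<Longrightarrow> f \<in> hom CC (Dom CC f) (Cod CC f)"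
  by (simp add: hom_def)

end

context C_system
begin

lemma Ob_n_0: "X \<in> Ob_n CC 0 G \<longleftrightarrow> X = G \<and> G \<in> Ob CC"
  by (auto simp: Ob_n_def)

lemma Ob_n_Suc:
  "X \<in> Ob_n CC (Suc n) G \<longleftrightarrow> X \<in> Ob CC \<and> 0 < len CC X \<and> ft CC X \<in> Ob_n CC n G"
proof -
  have "(ft CC ^^ Suc n) X = (ft CC ^^ n) (ft CC X)"
    by (simp only: funpow_Suc_right o_apply)
  then show ?thesis
    using len_ft[of X] ft_closed[of X] by (auto simp: Ob_n_def)
qed

lemma Ob_n_closed: "X \<in> Ob_n CC n G \<Longrightarrow> X \<in> Ob CC"
  by (simp add: Ob_n_def)

lemma Ob_n_base: "X \<in> Ob_n CC n G \<Longrightarrow> G \<in> Ob CC"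
  by (induction n arbitrary: X) (auto simp: Ob_n_0 Ob_n_Suc)

lemma Ob_n_len: "X \<in> Ob_n CC n G \<Longrightarrow> len CC X = len CC G + n"
  by (simp add: Ob_n_def)

lemma Ob_n_trans: "X \<in> Ob_n CC n Y \<Longrightarrow> Y \<in> Ob_n CC m G \<Longrightarrow> X \<in> Ob_n CC (n + m) G"
  by (induction n arbitrary: X) (auto simp: Ob_n_0 Ob_n_Suc)

lemma Ob_n_ft: "X \<in> Ob CC \<Longrightarrow> n \<le> len CC X \<Longrightarrow> X \<in> Ob_n CC n ((ft CC ^^ n) X)"
proof (induction n arbitrary: X)
  case 0
  then show ?case by (simp add: Ob_n_0)
next
  case (Suc n)
  have "(ft CC ^^ Suc n) X = (ft CC ^^ n) (ft CC X)"
    by (simp only: funpow_Suc_right o_apply)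
  then show ?case
    using Suc.IH[of "ft CC X"] Suc.prems len_ft[of X] ft_closed[of X]
    by (simp add: Ob_n_Suc del: funpow.simps)
qed

lemma Ob_ge2_iff: "B \<in> Ob_ge2 CC \<longleftrightarrow> B \<in> Ob_n CC 2 ((ft CC ^^ 2) B)"
  using Ob_n_ft[of B 2] by (auto simp: Ob_ge2_def Ob_n_def)

lemma Ob_n_2_ge2: "B \<in> Ob_n CC 2 G \<Longrightarrow> B \<in> Ob_ge2 CC"
  by (simp add: Ob_ge2_def Ob_n_def)

lemma Ob_n_over: "X \<in> Ob_n CC n G \<Longrightarrow> over CC X G"
  by (simp add: over_def Ob_n_def)

lemma pull_0: "f \<in> hom CC G' G \<Longrightarrow> pull CC f G = G'"
  and qm_0: "f \<in> hom CC G' G \<Longrightarrow> qm CC f G = f"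
  by (auto simp: pull_def qm_def hom_def)

lemma pull_Suc:
  assumes "f \<in> hom CC G' G" "X \<in> Ob_n CC (Suc n) G"
  shows "pull CC f X = pb1 CC (qm CC f (ft CC X)) X"
    and "qm CC f X = q1 CC (qm CC f (ft CC X)) X"
proof -
  have "len CC (ft CC X) - len CC G = n"
    using assms(2) Ob_n_len[of "ft CC X" n G] by (simp add: Ob_n_Suc)
  then show "pull CC f X = pb1 CC (qm CC f (ft CC X)) X"
    and "qm CC f X = q1 CC (qm CC f (ft CC X)) X"
    using Ob_n_len[OF assms(2)] hom_Cod[OF assms(1)] by (simp_all add: pull_def qm_def)
qed

lemma
  assumes f: "f \<in> hom CC G' G" and X: "X \<in> Ob_n CC n G"
  shows pull_Ob_n: "pull CC f X \<in> Ob_n CC n G'"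
    and qm_hom: "qm CC f X \<in> hom CC (pull CC f X) X"
proof -
  have "pull CC f X \<in> Ob_n CC n G' \<and> qm CC f X \<in> hom CC (pull CC f X) X"
    using X
  proof (induction n arbitrary: X)
    case 0
    then show ?case using f hom_Ob[OF f] by (simp add: Ob_n_0 pull_0[OF f] qm_0[OF f])
  next
    case (Suc n)
    from Suc.prems have X: "X \<in> Ob CC" "0 < len CC X" "ft CC X \<in> Ob_n CC n G"
      by (auto simp: Ob_n_Suc)
    show ?case
      unfolding pull_Suc[OF f Suc.prems] Ob_n_Suc
      using Suc.IH[OF X(3)] X pb1_closed q1_hom len_pb1 ft_pb1 by metis
  qed
  then show "pull CC f X \<in> Ob_n CC n G'" "qm CC f X \<in> hom CC (pull CC f X) X" by auto
qed

lemma ft_pull: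
  assumes f: "f \<in> hom CC G' G" and X: "X \<in> Ob_n CC (Suc n) G"
  shows "ft CC (pull CC f X) = pull CC f (ft CC X)"
  using X pull_Suc[OF f X] ft_pb1 qm_hom[OF f, of "ft CC X" n] by (auto simp: Ob_n_Suc)

lemma pull_pullback:
  assumes f: "f \<in> hom CC G' G" and X: "X \<in> Ob_n CC (Suc n) G"
  shows "is_pullback CC (pr CC (pull CC f X)) (qm CC f X) (qm CC f (ft CC X)) (pr CC X)"
  using X pull_Suc[OF f X] pb1_pullback qm_hom[OF f, of "ft CC X" n] by (auto simp: Ob_n_Suc)

lemma pr_hom_pull:
  assumes f: "f \<in> hom CC G' G" and X: "X \<in> Ob_n CC (Suc n) G"
  shows "pr CC (pull CC f X) \<in> hom CC (pull CC f X) (pull CC f (ft CC X))"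
  using pr_hom[OF Ob_n_closed[OF pull_Ob_n[OF f X]]] ft_pull[OF f X] by simp

lemma pr_qm:
  assumes f: "f \<in> hom CC G' G" and X: "X \<in> Ob_n CC (Suc n) G"
  shows "pr CC (pull CC f X) \<odot> qm CC f (ft CC X) = qm CC f X \<odot> pr CC X"
  using pull_pullback[OF f X] by (simp add: is_pullback_def)

lemma
  assumes f: "f \<in> hom CC G' G" and X: "X \<in> Ob_n CC (Suc n) G"
  shows pull_lift_step: "\<And>T a b. a \<in> hom CC T (pull CC f (ft CC X)) \<Longrightarrow> b \<in> hom CC T X \<Longrightarrow>
      a \<odot> qm CC f (ft CC X) = b \<odot> pr CC X \<Longrightarrow>
      \<exists>w \<in> hom CC T (pull CC f X). w \<odot> pr CC (pull CC f X) = a \<and> w \<odot> qm CC f X = b"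
    and pull_eq_step: "\<And>T w w'. w \<in> hom CC T (pull CC f X) \<Longrightarrow> w' \<in> hom CC T (pull CC f X) \<Longrightarrow>
      w \<odot> pr CC (pull CC f X) = w' \<odot> pr CC (pull CC f X) \<Longrightarrow>
      w \<odot> qm CC f X = w' \<odot> qm CC f X \<Longrightarrow> w = w'"
proof -
  have X': "X \<in> Ob CC" "ft CC X \<in> Ob_n CC n G" using X by (auto simp: Ob_n_Suc)
  have q: "qm CC f (ft CC X) \<in> hom CC (pull CC f (ft CC X)) (ft CC X)"
    by (rule qm_hom[OF f X'(2)])
  have Q: "qm CC f X \<in> hom CC (pull CC f X) X" by (rule qm_hom[OF f X])
  have p: "pr CC X \<in> hom CC X (ft CC X)" by (rule pr_hom[OF X'(1)])
  have p': "pr CC (pull CC f X) \<in> hom CC (pull CC f X) (pull CC f (ft CC X))"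
    by (rule pr_hom_pull[OF f X])
  have *: "\<exists>!w. w \<in> hom CC T (pull CC f X) \<and> w \<odot> pr CC (pull CC f X) = a \<and> w \<odot> qm CC f X = b"
    if "a \<in> hom CC T (pull CC f (ft CC X))" "b \<in> hom CC T X"
       "a \<odot> qm CC f (ft CC X) = b \<odot> pr CC X" for T a b
    using pull_pullback[OF f X] that hom_Ob[OF that(1)]
    unfolding is_pullback_def hom_Dom[OF q] hom_Dom[OF p] hom_Dom[OF p'] by blast
  show "\<exists>w \<in> hom CC T (pull CC f X). w \<odot> pr CC (pull CC f X) = a \<and> w \<odot> qm CC f X = b"
    if "a \<in> hom CC T (pull CC f (ft CC X))" "b \<in> hom CC T X"
       "a \<odot> qm CC f (ft CC X) = b \<odot> pr CC X" for T a b
    using *[OF that] by blast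
  show "w = w'"
    if w: "w \<in> hom CC T (pull CC f X)" and w': "w' \<in> hom CC T (pull CC f X)"
      and e: "w \<odot> pr CC (pull CC f X) = w' \<odot> pr CC (pull CC f X)"
        "w \<odot> qm CC f X = w' \<odot> qm CC f X" for T w w'
  proof -
    have "(w \<odot> pr CC (pull CC f X)) \<odot> qm CC f (ft CC X) = (w \<odot> qm CC f X) \<odot> pr CC X"
      by (simp add: Comp_assoc[OF w p' q] Comp_assoc[OF w Q p] pr_qm[OF f X])
    from *[OF Comp_hom[OF w p'] Comp_hom[OF w Q] this] w w' e show ?thesis by metis
  qed
qed

lemma
  assumes X: "X \<in> Ob_n CC n G"
  shows pull_Ident: "pull CC (Ident CC G) X = X"
    and qm_Ident: "qm CC (Ident CC G) X = Ident CC X"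
proof -
  have I: "Ident CC G \<in> hom CC G G" by (rule Ident_hom[OF Ob_n_base[OF X]])
  have "pull CC (Ident CC G) X = X \<and> qm CC (Ident CC G) X = Ident CC X"
    using X
  proof (induction n arbitrary: X)
    case 0
    then show ?case by (simp add: Ob_n_0 pull_0[OF I] qm_0[OF I])
  next
    case (Suc n)
    then have "X \<in> Ob CC" "0 < len CC X" "ft CC X \<in> Ob_n CC n G"
      by (auto simp: Ob_n_Suc)
    then show ?case
      by (simp add: pull_Suc[OF I Suc.prems] Suc.IH pb1_Ident q1_Ident)
  qed
  then show "pull CC (Ident CC G) X = X" "qm CC (Ident CC G) X = Ident CC X" by auto
qed

lemma
  assumes g: "g \<in> hom CC G'' G'" and f: "f \<in> hom CC G' G" and X: "X \<in> Ob_n CC n G"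
  shows pull_Comp: "pull CC (g \<odot> f) X = pull CC g (pull CC f X)"
    and qm_Comp: "qm CC (g \<odot> f) X = qm CC g (pull CC f X) \<odot> qm CC f X"
proof -
  have gf: "g \<odot> f \<in> hom CC G'' G" by (rule Comp_hom[OF g f])
  have "pull CC (g \<odot> f) X = pull CC g (pull CC f X) \<and>
      qm CC (g \<odot> f) X = qm CC g (pull CC f X) \<odot> qm CC f X"
    using X
  proof (induction n arbitrary: X)
    case 0
    then show ?case
      by (simp add: Ob_n_0 pull_0[OF gf] qm_0[OF gf] pull_0[OF f] qm_0[OF f] pull_0[OF g] qm_0[OF g])
  next
    case (Suc n)
    then have X: "X \<in> Ob CC" "0 < len CC X" "ft CC X \<in> Ob_n CC n G"
      by (auto simp: Ob_n_Suc)
    note qf = qm_hom[OF f X(3)]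
    note qg = qm_hom[OF g pull_Ob_n[OF f X(3)]]
    show ?case
      unfolding pull_Suc[OF gf Suc.prems] pull_Suc[OF g pull_Ob_n[OF f Suc.prems]]
        ft_pull[OF f Suc.prems]
      using Suc.IH[OF X(3)] pb1_Comp[OF X(1,2) qg qf] q1_Comp[OF X(1,2) qg qf]
      by (simp add: pull_Suc[OF f Suc.prems])
  qed
  then show "pull CC (g \<odot> f) X = pull CC g (pull CC f X)"
    "qm CC (g \<odot> f) X = qm CC g (pull CC f X) \<odot> qm CC f X" by auto
qed

text \<open>Pulling back along \<open>f\<close> can be done in stages, because both recursions peel off
  the top projections first: below an intermediate object \<open>Y\<close> only \<open>q(f, Y)\<close> remains.\<close>
lemma
  assumes f: "f \<in> hom CC G' G" and Y: "Y \<in> Ob_n CC m G" and X: "X \<in> Ob_n CC n Y"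
  shows pull_stage: "pull CC (qm CC f Y) X = pull CC f X"
    and qm_stage: "qm CC (qm CC f Y) X = qm CC f X"
proof -
  note q = qm_hom[OF f Y]
  have "pull CC (qm CC f Y) X = pull CC f X \<and> qm CC (qm CC f Y) X = qm CC f X"
    using X
  proof (induction n arbitrary: X)
    case 0
    then show ?case by (simp add: Ob_n_0 pull_0[OF q] qm_0[OF q])
  next
    case (Suc n)
    have X: "X \<in> Ob_n CC (Suc (n + m)) G" using Ob_n_trans[OF Suc.prems Y] by simp
    from Suc show ?case
      by (simp add: pull_Suc[OF q Suc.prems] pull_Suc[OF f X] Ob_n_Suc)
  qed
  then show "pull CC (qm CC f Y) X = pull CC f X" "qm CC (qm CC f Y) X = qm CC f X" by auto
qed

section \<open>Morphisms over an object and their pullbacks\<close>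

lemma proj_0: "proj CC G G = Ident CC G"
  by (simp add: proj_def)

lemma proj_Suc:
  "X \<in> Ob_n CC (Suc n) G \<Longrightarrow> proj CC X G = pr CC X \<odot> proj CC (ft CC X) G"
  by (simp add: proj_def Ob_n_Suc Ob_n_def len_ft)

lemma proj_hom: "X \<in> Ob_n CC n G \<Longrightarrow> proj CC X G \<in> hom CC X G"
proof (induction n arbitrary: X)
  case 0
  then show ?case by (simp add: Ob_n_0 proj_0 Ident_hom)
next
  case (Suc n)
  then show ?case using Comp_hom[OF pr_hom] by (simp add: proj_Suc) (simp add: Ob_n_Suc)
qed

lemma proj_1:
  assumes "X \<in> Ob_n CC 1 G"
  shows "proj CC X G = pr CC X"
  using assms proj_Suc[of X 0 G] pr_hom[of X] Ident_right[of "pr CC X" X G]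
  by (simp add: Ob_n_Suc Ob_n_0 proj_0)

text \<open>Stacking the canonical squares over a tower of length \<open>n\<close> gives a commutative and
  cartesian square again; its universal property is what makes the pullback of a
  morphism over \<open>G\<close> exist and be unique.\<close>
lemma pull_lift:
  assumes f: "f \<in> hom CC G' G" and X: "X \<in> Ob_n CC n G"
    and a: "a \<in> hom CC T G'" and b: "b \<in> hom CC T X"
    and e: "a \<odot> f = b \<odot> proj CC X G"
  shows "\<exists>w \<in> hom CC T (pull CC f X). w \<odot> proj CC (pull CC f X) G' = a \<and> w \<odot> qm CC f X = b"
  using X b e
proof (induction n arbitrary: X b)
  case 0
  then show ?case using a Ident_right[OF a] Ident_right[OF 0(2)]
    by (auto simp: Ob_n_0 pull_0[OF f] qm_0[OF f] proj_0)
next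
  case (Suc n)
  note X = Suc.prems(1)
  note fX = pull_Ob_n[OF f X]
  have ftX: "ft CC X \<in> Ob_n CC n G" and "X \<in> Ob CC" using X by (auto simp: Ob_n_Suc)
  have p: "pr CC X \<in> hom CC X (ft CC X)" using \<open>X \<in> Ob CC\<close> by (rule pr_hom)
  have "a \<odot> f = (b \<odot> pr CC X) \<odot> proj CC (ft CC X) G"
    using Suc.prems(3) by (simp add: proj_Suc[OF X] Comp_assoc[OF Suc.prems(2) p proj_hom[OF ftX]])
  from Suc.IH[OF ftX Comp_hom[OF Suc.prems(2) p] this]
  obtain w where w: "w \<in> hom CC T (pull CC f (ft CC X))"
    "w \<odot> proj CC (pull CC f (ft CC X)) G' = a" "w \<odot> qm CC f (ft CC X) = b \<odot> pr CC X" by auto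
  from pull_lift_step[OF f X w(1) Suc.prems(2) w(3)]
  obtain v where v: "v \<in> hom CC T (pull CC f X)" "v \<odot> pr CC (pull CC f X) = w"
    "v \<odot> qm CC f X = b" by auto
  have "v \<odot> proj CC (pull CC f X) G' = a"
    using v(2) w(2) Comp_assoc[OF v(1) pr_hom_pull[OF f X] proj_hom[OF pull_Ob_n[OF f ftX]]]
    by (simp add: proj_Suc[OF fX] ft_pull[OF f X])
  with v show ?case by auto
qed

lemma pull_eqI:
  assumes f: "f \<in> hom CC G' G" and X: "X \<in> Ob_n CC n G"
    and w: "w \<in> hom CC T (pull CC f X)" "w' \<in> hom CC T (pull CC f X)"
    and e: "w \<odot> proj CC (pull CC f X) G' = w' \<odot> proj CC (pull CC f X) G'"
      "w \<odot> qm CC f X = w' \<odot> qm CC f X"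
  shows "w = w'"
  using X w e
proof (induction n arbitrary: X w w')
  case 0
  then show ?case
    using Ident_right[OF 0(2)] Ident_right[OF 0(3)] by (simp add: Ob_n_0 pull_0[OF f] proj_0)
next
  case (Suc n)
  note X = Suc.prems(1)
  note w = Suc.prems(2,3)
  note fX = pull_Ob_n[OF f X]
  have ftX: "ft CC X \<in> Ob_n CC n G" and "X \<in> Ob CC" using X by (auto simp: Ob_n_Suc)
  have p: "pr CC X \<in> hom CC X (ft CC X)" using \<open>X \<in> Ob CC\<close> by (rule pr_hom)
  note p' = pr_hom_pull[OF f X]
  note q = qm_hom[OF f ftX] and q' = qm_hom[OF f X]
  have "(u \<odot> pr CC (pull CC f X)) \<odot> proj CC (pull CC f (ft CC X)) G' = u \<odot> proj CC (pull CC f X) G'"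
    "(u \<odot> pr CC (pull CC f X)) \<odot> qm CC f (ft CC X) = (u \<odot> qm CC f X) \<odot> pr CC X"
    if u: "u \<in> hom CC T (pull CC f X)" for u
    using Comp_assoc[OF u p' proj_hom[OF pull_Ob_n[OF f ftX]]]
    by (simp_all add: proj_Suc[OF fX] ft_pull[OF f X] Comp_assoc[OF u p' q] Comp_assoc[OF u q' p] pr_qm[OF f X])
  then have "w \<odot> pr CC (pull CC f X) = w' \<odot> pr CC (pull CC f X)"
    using Suc.IH[OF ftX Comp_hom[OF w(1) p'] Comp_hom[OF w(2) p']] w Suc.prems(4,5) by simp
  then show ?case using pull_eq_step[OF f X w] Suc.prems(5) by simp
qed

lemma qm_proj:
  assumes f: "f \<in> hom CC G' G" and X: "X \<in> Ob_n CC n G"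
  shows "proj CC (pull CC f X) G' \<odot> f = qm CC f X \<odot> proj CC X G"
  using X
proof (induction n arbitrary: X)
  case 0
  then show ?case
    using Ident_left[OF f] Ident_right[OF f] by (simp add: Ob_n_0 pull_0[OF f] qm_0[OF f] proj_0)
next
  case (Suc n)
  note X = Suc.prems
  note fX = pull_Ob_n[OF f X]
  have ftX: "ft CC X \<in> Ob_n CC n G" and "X \<in> Ob CC" using X by (auto simp: Ob_n_Suc)
  have p: "pr CC X \<in> hom CC X (ft CC X)" using \<open>X \<in> Ob CC\<close> by (rule pr_hom)
  note p' = pr_hom_pull[OF f X]
  note q = qm_hom[OF f ftX] and q' = qm_hom[OF f X]
  show ?case
    using Comp_assoc[OF p' proj_hom[OF pull_Ob_n[OF f ftX]] f] Suc.IH[OF ftX] pr_qm[OF f X]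
      Comp_assoc[OF p' q proj_hom[OF ftX]] Comp_assoc[OF q' p proj_hom[OF ftX]]
    by (simp add: proj_Suc[OF fX] proj_Suc[OF X] ft_pull[OF f X])
qed

lemma pull_mor_eqI:
  assumes f: "f \<in> hom CC G' G" and X: "X \<in> Ob_n CC m G" and Y: "Y \<in> Ob_n CC n G"
    and a: "a \<in> hom CC X Y"
    and b: "b \<in> hom CC (pull CC f X) (pull CC f Y)"
    and bp: "b \<odot> proj CC (pull CC f Y) G' = proj CC (pull CC f X) G'"
    and bq: "b \<odot> qm CC f Y = qm CC f X \<odot> a"
  shows "pull_mor CC f a = b"
  unfolding pull_mor_def hom_Dom[OF a] hom_Cod[OF a] hom_Dom[OF f]
proof (rule the_equality)
  have "b \<in> Mor CC" using b by (simp add: hom_def)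
  then show "b \<in> hom CC (pull CC f X) (pull CC f Y) \<and> mor_over CC G' b \<and>
      b \<odot> qm CC f Y = qm CC f X \<odot> a"
    using b bp bq Ob_n_over[OF pull_Ob_n[OF f X]] Ob_n_over[OF pull_Ob_n[OF f Y]]
    by (simp add: mor_over_def hom_Dom[OF b] hom_Cod[OF b])
next
  fix c
  assume c: "c \<in> hom CC (pull CC f X) (pull CC f Y) \<and> mor_over CC G' c \<and>
      c \<odot> qm CC f Y = qm CC f X \<odot> a"
  then have c': "c \<in> hom CC (pull CC f X) (pull CC f Y)" by simp
  from c have "c \<odot> proj CC (pull CC f Y) G' = proj CC (pull CC f X) G'"
    by (simp add: mor_over_def hom_Dom[OF c'] hom_Cod[OF c'])
  then show "c = b" using pull_eqI[OF f Y c' b] c bp bq by simp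
qed

text \<open>Existence of the pullback of a morphism over \<open>G\<close>; only with it does the definite
  description in \<open>pull_mor\<close> yield its defining equations.\<close>
lemma
  assumes f: "f \<in> hom CC G' G" and X: "X \<in> Ob_n CC m G" and Y: "Y \<in> Ob_n CC n G"
    and a: "a \<in> hom CC X Y" and ap: "a \<odot> proj CC Y G = proj CC X G"
  shows pull_mor_hom: "pull_mor CC f a \<in> hom CC (pull CC f X) (pull CC f Y)"
    and pull_mor_proj: "pull_mor CC f a \<odot> proj CC (pull CC f Y) G' = proj CC (pull CC f X) G'"
    and pull_mor_qm: "pull_mor CC f a \<odot> qm CC f Y = qm CC f X \<odot> a"
proof -
  note q = qm_hom[OF f X]
  have "proj CC (pull CC f X) G' \<odot> f = (qm CC f X \<odot> a) \<odot> proj CC Y G"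
    using qm_proj[OF f X] Comp_assoc[OF q a proj_hom[OF Y]] ap by simp
  from pull_lift[OF f Y proj_hom[OF pull_Ob_n[OF f X]] Comp_hom[OF q a] this]
  obtain b where "b \<in> hom CC (pull CC f X) (pull CC f Y)"
    "b \<odot> proj CC (pull CC f Y) G' = proj CC (pull CC f X) G'"
    "b \<odot> qm CC f Y = qm CC f X \<odot> a" by auto
  with pull_mor_eqI[OF f X Y a]
  show "pull_mor CC f a \<in> hom CC (pull CC f X) (pull CC f Y)"
    "pull_mor CC f a \<odot> proj CC (pull CC f Y) G' = proj CC (pull CC f X) G'"
    "pull_mor CC f a \<odot> qm CC f Y = qm CC f X \<odot> a" by auto
qed

lemma over_pt: "X \<in> Ob CC \<Longrightarrow> over CC X (pt CC)"
proof -
  assume "X \<in> Ob CC"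
  then have X: "X \<in> Ob_n CC (len CC X) ((ft CC ^^ len CC X) X)" by (rule Ob_n_ft) simp
  have "len CC ((ft CC ^^ len CC X) X) = 0" using Ob_n_len[OF X] by linarith
  then have "(ft CC ^^ len CC X) X = pt CC" using Ob_n_base[OF X] len_eq_0 by blast
  with X show ?thesis using Ob_n_over by simp
qed

lemma del_fiber_iff:
  "s \<in> del_fiber CC X \<longleftrightarrow>
     X \<in> Ob CC \<and> 0 < len CC X \<and> s \<in> hom CC (ft CC X) X \<and> s \<odot> pr CC X = Ident CC (ft CC X)"
proof -
  have "len CC (pt CC) = 0" using len_eq_0 by blast
  moreover have "Cod CC (pr CC X) = ft CC X" "Dom CC (pr CC X) = X" if "X \<in> Ob CC"
    using pr_hom[OF that] by (auto simp: hom_def)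
  moreover have "X \<in> Ob CC" if "s \<in> Mor CC" "Cod CC s = X" using that Cod_closed by auto
  ultimately show ?thesis
    using over_pt[of X]
    by (auto simp: del_fiber_def Ob_tilde_def sec_def strictly_over_def hom_def)
qed

text \<open>A section of \<open>p\<^sub>X\<close> is a morphism over every object below \<open>X\<close>, so it can be pulled back.\<close>
lemma
  assumes f: "f \<in> hom CC G' G" and X: "X \<in> Ob_n CC (Suc n) G" and s: "s \<in> del_fiber CC X"
  shows pull_sec: "pull_mor CC f s \<in> del_fiber CC (pull CC f X)"
    and pull_sec_qm: "pull_mor CC f s \<odot> qm CC f X = qm CC f (ft CC X) \<odot> s"
proof -
  have X': "X \<in> Ob CC" "ft CC X \<in> Ob_n CC n G" using X by (auto simp: Ob_n_Suc)
  have s': "s \<in> hom CC (ft CC X) X" "s \<odot> pr CC X = Ident CC (ft CC X)"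
    using s by (auto simp: del_fiber_iff)
  note p = pr_hom[OF X'(1)] and p' = pr_hom_pull[OF f X]
  note q = qm_hom[OF f X] and q' = qm_hom[OF f X'(2)]
  note pj = proj_hom[OF X'(2)] and pj' = proj_hom[OF pull_Ob_n[OF f X'(2)]]
  have "s \<odot> proj CC X G = proj CC (ft CC X) G"
    using Comp_assoc[OF s'(1) p pj] s'(2) Ident_left[OF pj] by (simp add: proj_Suc[OF X])
  note t = pull_mor_hom[OF f X'(2) X s'(1) this] pull_mor_proj[OF f X'(2) X s'(1) this]
    pull_mor_qm[OF f X'(2) X s'(1) this]
  have "pull_mor CC f s \<odot> pr CC (pull CC f X) = Ident CC (pull CC f (ft CC X))"
  proof (rule pull_eqI[OF f X'(2)])
    show "pull_mor CC f s \<odot> pr CC (pull CC f X) \<odot> proj CC (pull CC f (ft CC X)) G' =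
      Ident CC (pull CC f (ft CC X)) \<odot> proj CC (pull CC f (ft CC X)) G'"
      using Comp_assoc[OF t(1) p' pj'] t(2) Ident_left[OF pj']
      by (simp add: proj_Suc[OF pull_Ob_n[OF f X]] ft_pull[OF f X])
    show "pull_mor CC f s \<odot> pr CC (pull CC f X) \<odot> qm CC f (ft CC X) =
      Ident CC (pull CC f (ft CC X)) \<odot> qm CC f (ft CC X)"
      using Comp_assoc[OF t(1) p' q'] pr_qm[OF f X] Comp_assoc[OF t(1) q p] t(3)
        Comp_assoc[OF q' s'(1) p] s'(2) Ident_right[OF q'] Ident_left[OF q'] by simp
  qed (use Comp_hom[OF t(1) p'] Ident_hom hom_Ob(1)[OF q'] in auto)
  with t show "pull_mor CC f s \<in> del_fiber CC (pull CC f X)"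
    using pull_Ob_n[OF f X] by (simp add: del_fiber_iff ft_pull[OF f X] Ob_n_Suc)
  show "pull_mor CC f s \<odot> qm CC f X = qm CC f (ft CC X) \<odot> s" by (rule t(3))
qed

lemma pull_sec_eqI:
  assumes f: "f \<in> hom CC G' G" and X: "X \<in> Ob_n CC (Suc n) G" and s: "s \<in> del_fiber CC X"
    and t: "t \<in> del_fiber CC (pull CC f X)" and e: "t \<odot> qm CC f X = qm CC f (ft CC X) \<odot> s"
  shows "pull_mor CC f s = t"
proof (rule pull_eq_step[OF f X])
  show "pull_mor CC f s \<in> hom CC (pull CC f (ft CC X)) (pull CC f X)"
    "t \<in> hom CC (pull CC f (ft CC X)) (pull CC f X)"
    "pull_mor CC f s \<odot> pr CC (pull CC f X) = t \<odot> pr CC (pull CC f X)"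
    using t pull_sec[OF f X s] by (simp_all add: del_fiber_iff ft_pull[OF f X])
  show "pull_mor CC f s \<odot> qm CC f X = t \<odot> qm CC f X"
    using pull_sec_qm[OF f X s] e by simp
qed

end

section \<open>Fiber products and the diagonal\<close>

context C_system
begin

lemma Ob_n_1D:
  assumes "X \<in> Ob_n CC 1 G"
  shows "X \<in> Ob CC" "ft CC X = G" "pr CC X \<in> hom CC X G" "X \<in> Ob_n CC (Suc 0) G"
proof -
  show X: "X \<in> Ob_n CC (Suc 0) G" using assms by simp
  then show "X \<in> Ob CC" "ft CC X = G" by (simp_all add: Ob_n_Suc Ob_n_0)
  then show "pr CC X \<in> hom CC X G" using pr_hom by metis
qed

lemma fprod_1: "X \<in> Ob_n CC 1 G \<Longrightarrow> fprod CC G X Y = pull CC (pr CC X) Y"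
  by (simp only: fprod_def proj_1)

lemma Ob_n_2D:
  assumes "B \<in> Ob_n CC 2 G"
  shows "B \<in> Ob CC" "(ft CC ^^ 2) B = G" "ft CC B \<in> Ob_n CC 1 G" "B \<in> Ob_n CC 1 (ft CC B)"
    "B \<in> Ob_n CC (Suc (Suc 0)) G"
proof -
  show B: "B \<in> Ob_n CC (Suc (Suc 0)) G" using assms by (simp add: numeral_2_eq_2)
  then show "B \<in> Ob CC" "ft CC B \<in> Ob_n CC 1 G" by (simp_all add: Ob_n_Suc)
  then show "B \<in> Ob_n CC 1 (ft CC B)" using B by (simp add: Ob_n_Suc Ob_n_0)
  show "(ft CC ^^ 2) B = G" using assms by (simp add: Ob_n_def)
qed

lemma ft_pull_2: "f \<in> hom CC G' G \<Longrightarrow> B \<in> Ob_n CC 2 G \<Longrightarrow> ft CC (pull CC f B) = pull CC f (ft CC B)"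
  using ft_pull Ob_n_2D(5) by blast

text \<open>In both equations the two sides are computed along the same morphism, the composite
  \<open>q(f, X) \<odot> p\<^sub>X = p \<odot> f\<close> across the canonical square; \<open>pull_stage\<close> turns pulling back along
  \<open>f\<close> into pulling back along \<open>q(f, X)\<close>.\<close>
lemma
  assumes f: "f \<in> hom CC G' G" and X: "X \<in> Ob_n CC 1 G" and Y: "Y \<in> Ob_n CC n G"
  shows pull_fprod: "pull CC f (pull CC (pr CC X) Y) = pull CC (pr CC (pull CC f X)) (pull CC f Y)"
    and qm_fprod: "qm CC f (pull CC (pr CC X) Y) \<odot> qm CC (pr CC X) Y =
      qm CC (pr CC (pull CC f X)) (pull CC f Y) \<odot> qm CC f Y"
proof -
  note X1 = Ob_n_1D[OF X] and X1' = Ob_n_1D[OF pull_Ob_n[OF f X]]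
  note h = qm_hom[OF f X]
  note pY = pull_Ob_n[OF X1(3) Y]
  have e: "qm CC f X \<odot> pr CC X = pr CC (pull CC f X) \<odot> f"
    using pr_qm[OF f X1(4)] by (simp add: X1(2) qm_0[OF f])
  show "pull CC f (pull CC (pr CC X) Y) = pull CC (pr CC (pull CC f X)) (pull CC f Y)"
    using pull_stage[OF f X pY] pull_Comp[OF h X1(3) Y] pull_Comp[OF X1'(3) f Y] e by simp
  show "qm CC f (pull CC (pr CC X) Y) \<odot> qm CC (pr CC X) Y =
      qm CC (pr CC (pull CC f X)) (pull CC f Y) \<odot> qm CC f Y"
    using qm_stage[OF f X pY] qm_Comp[OF h X1(3) Y] qm_Comp[OF X1'(3) f Y] e by simp
qed

text \<open>Substituting a section into the projection that it splits is substitution along an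
  identity, which is strictly trivial.\<close>
lemma
  assumes X: "X \<in> Ob_n CC 1 G" and s: "s \<in> del_fiber CC X" and Y: "Y \<in> Ob_n CC n G"
  shows pull_sec_fprod: "pull CC s (pull CC (pr CC X) Y) = Y"
    and qm_sec_fprod: "qm CC s (pull CC (pr CC X) Y) \<odot> qm CC (pr CC X) Y = Ident CC Y"
proof -
  note X1 = Ob_n_1D[OF X]
  have s': "s \<in> hom CC G X" "s \<odot> pr CC X = Ident CC G" using s X1 by (auto simp: del_fiber_iff)
  show "pull CC s (pull CC (pr CC X) Y) = Y"
    using pull_Comp[OF s'(1) X1(3) Y] pull_Ident[OF Y] s'(2) by simp
  show "qm CC s (pull CC (pr CC X) Y) \<odot> qm CC (pr CC X) Y = Ident CC Y"
    using qm_Comp[OF s'(1) X1(3) Y] qm_Ident[OF Y] s'(2) by simp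
qed

lemma diagonal_ex1:
  assumes X: "X \<in> Ob_n CC 1 G"
  shows "\<exists>!d. is_diagonal CC G X d"
proof -
  note X1 = Ob_n_1D[OF X]
  note f = X1(3)
  have I: "Ident CC X \<in> hom CC X X" by (rule Ident_hom[OF X1(1)])
  show ?thesis
  proof (rule ex_ex1I)
    have "\<exists>w\<in>hom CC X (pull CC (pr CC X) X).
        w \<odot> pr CC (pull CC (pr CC X) X) = Ident CC X \<and> w \<odot> qm CC (pr CC X) X = Ident CC X"
      using pull_lift_step[OF f X1(4), of "Ident CC X" X "Ident CC X"] I
      by (simp add: X1(2) pull_0[OF f] qm_0[OF f])
    then show "\<exists>d. is_diagonal CC G X d"
      unfolding is_diagonal_def fprod_1[OF X] by blast
  next
    fix d d' assume "is_diagonal CC G X d" "is_diagonal CC G X d'"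
    then show "d = d'"
      unfolding is_diagonal_def fprod_1[OF X] by (intro pull_eq_step[OF f X1(4), of d X d']) simp_all
  qed
qed

lemma is_diagonal_diagonal: "X \<in> Ob_n CC 1 G \<Longrightarrow> is_diagonal CC G X (diagonal CC G X)"
  unfolding diagonal_def by (rule theI'[OF diagonal_ex1])

lemma diagonal_eqI: "X \<in> Ob_n CC 1 G \<Longrightarrow> is_diagonal CC G X d \<Longrightarrow> diagonal CC G X = d"
  using diagonal_ex1 is_diagonal_diagonal by blast

lemma
  assumes X: "X \<in> Ob_n CC 1 G"
  shows fprod_self_Ob_n: "pull CC (pr CC X) X \<in> Ob_n CC 1 X"
    and ft_fprod_self: "ft CC (pull CC (pr CC X) X) = X"
    and diagonal_sec: "diagonal CC G X \<in> del_fiber CC (pull CC (pr CC X) X)"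
    and diagonal_hom: "diagonal CC G X \<in> hom CC X (pull CC (pr CC X) X)"
    and diagonal_qm: "diagonal CC G X \<odot> qm CC (pr CC X) X = Ident CC X"
proof -
  note X1 = Ob_n_1D[OF X]
  show XX: "pull CC (pr CC X) X \<in> Ob_n CC 1 X" by (rule pull_Ob_n[OF X1(3) X])
  show ft: "ft CC (pull CC (pr CC X) X) = X"
    using ft_pull[OF X1(3,4)] X1(2) pull_0[OF X1(3)] by simp
  show "diagonal CC G X \<in> del_fiber CC (pull CC (pr CC X) X)"
    "diagonal CC G X \<in> hom CC X (pull CC (pr CC X) X)"
    "diagonal CC G X \<odot> qm CC (pr CC X) X = Ident CC X"
    using is_diagonal_diagonal[OF X] Ob_n_closed[OF XX] Ob_n_len[OF XX]
    unfolding is_diagonal_def fprod_1[OF X] del_fiber_iff ft by simp_all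
qed

text \<open>The diagonal is the generic section of \<open>p\<^sub>X\<close>: every section is its pullback along itself.\<close>
lemma pull_sec_diagonal:
  assumes X: "X \<in> Ob_n CC 1 G" and s: "s \<in> del_fiber CC X"
  shows "pull_mor CC s (diagonal CC G X) = s"
proof -
  note X1 = Ob_n_1D[OF X]
  note XX = Ob_n_1D[OF fprod_self_Ob_n[OF X]]
  have s': "s \<in> hom CC G X" using s X1 by (auto simp: del_fiber_iff)
  let ?t = "pull_mor CC s (diagonal CC G X)"
  have "?t \<in> del_fiber CC X"
    using pull_sec[OF s' XX(4) diagonal_sec[OF X]] pull_sec_fprod[OF X s X] by simp
  then have t: "?t \<in> hom CC G X" using X1 by (simp add: del_fiber_iff)
  have tq: "?t \<odot> qm CC s (pull CC (pr CC X) X) = s \<odot> diagonal CC G X"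
    using pull_sec_qm[OF s' XX(4) diagonal_sec[OF X]] XX(2) qm_0[OF s'] by simp
  note q = qm_hom[OF s' fprod_self_Ob_n[OF X]] and qX = qm_hom[OF X1(3) X]
  have q': "qm CC s (pull CC (pr CC X) X) \<in> hom CC X (pull CC (pr CC X) X)"
    using q pull_sec_fprod[OF X s X] by simp
  have "?t = ?t \<odot> (qm CC s (pull CC (pr CC X) X) \<odot> qm CC (pr CC X) X)"
    using Ident_right[OF t] qm_sec_fprod[OF X s X] by simp
  also have "\<dots> = (s \<odot> diagonal CC G X) \<odot> qm CC (pr CC X) X"
    by (simp only: Comp_assoc[OF t q' qX, symmetric] tq)
  also have "\<dots> = s"
    using Comp_assoc[OF s' diagonal_hom[OF X] qX] diagonal_qm[OF X] Ident_right[OF s'] by simp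
  finally show ?thesis .
qed

text \<open>The pullback \<open>t\<close> of the diagonal is a section of the first projection by construction.
  That it also splits the second one is tested against the two legs \<open>q(f, X)\<close> and \<open>p\<close> of the
  pullback \<open>f\<^sup>*(X)\<close>.\<close>
lemma pull_qm_diagonal:
  assumes f: "f \<in> hom CC G' G" and X: "X \<in> Ob_n CC 1 G"
  shows "pull_mor CC (qm CC f X) (diagonal CC G X) = diagonal CC G' (pull CC f X)"
proof -
  note X1 = Ob_n_1D[OF X]
  define X' where "X' = pull CC f X"
  define h where "h = qm CC f X"
  define d where "d = diagonal CC G X"
  have X': "X' \<in> Ob_n CC 1 G'" unfolding X'_def by (rule pull_Ob_n[OF f X])
  note X1' = Ob_n_1D[OF X']
  have h: "h \<in> hom CC X' X" unfolding h_def X'_def by (rule qm_hom[OF f X])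
  note XX = Ob_n_1D[OF fprod_self_Ob_n[OF X]]
  note XX' = Ob_n_1D[OF fprod_self_Ob_n[OF X']]
  have pXX: "pull CC h (pull CC (pr CC X) X) = pull CC (pr CC X') X'"
    using pull_stage[OF f X fprod_self_Ob_n[OF X]] pull_fprod[OF f X X] by (simp add: h_def X'_def)
  have qXX: "qm CC h (pull CC (pr CC X) X) \<odot> qm CC (pr CC X) X = qm CC (pr CC X') X' \<odot> h"
    using qm_stage[OF f X fprod_self_Ob_n[OF X]] qm_fprod[OF f X X] by (simp add: h_def X'_def)
  define t where "t = pull_mor CC h d"
  have ts: "t \<in> del_fiber CC (pull CC (pr CC X') X')"
    using pull_sec[OF h XX(4) diagonal_sec[OF X]] pXX by (simp add: t_def d_def)
  then have t: "t \<in> hom CC X' (pull CC (pr CC X') X')"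
    and tp: "t \<odot> pr CC (pull CC (pr CC X') X') = Ident CC X'"
    by (auto simp: del_fiber_iff ft_fprod_self[OF X'])
  have tq: "t \<odot> qm CC h (pull CC (pr CC X) X) = h \<odot> d"
    using pull_sec_qm[OF h XX(4) diagonal_sec[OF X]] XX(2) qm_0[OF h] by (simp add: t_def d_def)
  note qX = qm_hom[OF X1(3) X] and qX' = qm_hom[OF X1'(3) X']
  have q: "qm CC h (pull CC (pr CC X) X) \<in> hom CC (pull CC (pr CC X') X') (pull CC (pr CC X) X)"
    using qm_hom[OF h fprod_self_Ob_n[OF X]] pXX by simp
  have d: "d \<in> hom CC X (pull CC (pr CC X) X)" "d \<odot> qm CC (pr CC X) X = Ident CC X"
    using diagonal_hom[OF X] diagonal_qm[OF X] by (auto simp: d_def)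
  have tqq: "t \<odot> qm CC (pr CC X') X' = Ident CC X'"
  proof (rule pull_eq_step[OF f X1(4), folded X'_def h_def])
    have "t \<odot> qm CC (pr CC X') X' \<odot> h = t \<odot> qm CC h (pull CC (pr CC X) X) \<odot> qm CC (pr CC X) X"
      by (simp add: Comp_assoc[OF t qX' h] Comp_assoc[OF t q qX] qXX)
    also have "\<dots> = h" by (simp add: tq Comp_assoc[OF h d(1) qX] d(2) Ident_right[OF h])
    finally show "t \<odot> qm CC (pr CC X') X' \<odot> h = Ident CC X' \<odot> h" by (simp add: Ident_left[OF h])
    have "qm CC (pr CC X') X' \<odot> pr CC X' = pr CC (pull CC (pr CC X') X') \<odot> pr CC X'"
      using pr_qm[OF X1'(3,4)] X1'(2) qm_0[OF X1'(3)] by simp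
    then show "t \<odot> qm CC (pr CC X') X' \<odot> pr CC X' = Ident CC X' \<odot> pr CC X'"
      using Comp_assoc[OF t qX' X1'(3)] Comp_assoc[OF t XX'(3) X1'(3)] tp by simp
  qed (use Comp_hom[OF t qX'] Ident_hom[OF X1'(1)] in auto)
  have "is_diagonal CC G' X' t"
    using t tp tqq by (simp add: is_diagonal_def fprod_1[OF X'])
  then show ?thesis using diagonal_eqI[OF X'] by (simp add: t_def d_def h_def X'_def)
qed

end

section \<open>Families of bijections and of evaluation morphisms\<close>

locale C_system_Pi = C_system CC for CC :: "('o, 'm) csys" (structure) +
  fixes P :: "'o \<Rightarrow> 'o \<Rightarrow> 'o"
  assumes P_morphism: "presheaf_morphism CC (Ob_n CC 2) (pull CC) (Ob_n CC 1) (pull CC) P"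
begin

lemma P_Ob_n: "B \<in> Ob_n CC 2 G \<Longrightarrow> P G B \<in> Ob_n CC 1 G"
  using P_morphism Ob_n_base[of B 2 G] by (auto simp: presheaf_morphism_def)

lemma P_pull: "f \<in> hom CC G' G \<Longrightarrow> B \<in> Ob_n CC 2 G \<Longrightarrow> P G' (pull CC f B) = pull CC f (P G B)"
  using P_morphism by (auto simp: presheaf_morphism_def hom_def)

lemma bold_P: "B \<in> Ob_n CC 2 G \<Longrightarrow> bold CC P B = P G B"
  by (simp only: bold_def Ob_n_2D(2))

lemma lambda_inv_eq:
  "B \<in> Ob_n CC 2 G \<Longrightarrow>
    lambda_inv CC (bold CC P) Ap B s = qm CC s (pull CC (pr CC (P G B)) (ft CC B)) \<odot> Ap B"
  by (simp only: lambda_inv_def bold_P Ob_n_2D(2) fprod_1[OF P_Ob_n])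

text \<open>The triangle over \<open>A\<close> makes \<open>a\<close> and \<open>a'\<close> morphisms over \<open>G\<close> and \<open>G'\<close>, so
  stability under pullback amounts to the commutation of a square; this form avoids the description operator hidden in \<open>pull_mor\<close>.\<close>
lemma pull_Ap_iff:
  assumes f: "f \<in> hom CC G' G" and B: "B \<in> Ob_n CC 2 G"
    and a: "a \<in> hom CC (pull CC (pr CC (P G B)) (ft CC B)) B"
    and ap: "a \<odot> pr CC B = qm CC (pr CC (P G B)) (ft CC B)"
    and a': "a' \<in> hom CC (pull CC (pr CC (pull CC f (P G B))) (pull CC f (ft CC B))) (pull CC f B)"
    and ap': "a' \<odot> pr CC (pull CC f B) = qm CC (pr CC (pull CC f (P G B))) (pull CC f (ft CC B))"
  shows "pull_mor CC f a = a' \<longleftrightarrow>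
    a' \<odot> qm CC f B = qm CC f (pull CC (pr CC (P G B)) (ft CC B)) \<odot> a"
proof -
  have over: "c \<odot> proj CC Y H = proj CC (pull CC (pr CC R) (ft CC Y)) H"
    if Y: "Y \<in> Ob_n CC 2 H" and R: "R \<in> Ob_n CC 1 H"
      and c: "c \<in> hom CC (pull CC (pr CC R) (ft CC Y)) Y" "c \<odot> pr CC Y = qm CC (pr CC R) (ft CC Y)"
    for c Y H R
  proof -
    note Y2 = Ob_n_2D[OF Y] and R1 = Ob_n_1D[OF R]
    note A = Ob_n_1D[OF Y2(3)]
    have "R \<in> Ob_n CC (Suc 0) H" by (rule R1(4))
    then have RA: "pull CC (pr CC R) (ft CC Y) \<in> Ob_n CC (Suc 1) H"
      using Ob_n_trans[OF pull_Ob_n[OF R1(3) Y2(3)] R] by simp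
    have ftRA: "ft CC (pull CC (pr CC R) (ft CC Y)) = R"
      using ft_pull[OF R1(3) A(4)] A(2) pull_0[OF R1(3)] by simp
    have Y': "Y \<in> Ob_n CC (Suc 1) H" using Y by (simp add: numeral_2_eq_2)
    have "c \<odot> proj CC Y H = c \<odot> pr CC Y \<odot> pr CC (ft CC Y)"
      using Comp_assoc[OF c(1) pr_hom[OF Y2(1)] A(3)] by (simp only: proj_Suc[OF Y'] proj_1[OF Y2(3)])
    also have "\<dots> = pr CC (pull CC (pr CC R) (ft CC Y)) \<odot> pr CC R"
      using pr_qm[OF R1(3) A(4)] by (simp add: c(2) A(2) qm_0[OF R1(3)])
    also have "\<dots> = proj CC (pull CC (pr CC R) (ft CC Y)) H"
      by (simp only: proj_Suc[OF RA] ftRA proj_1[OF R])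
    finally show ?thesis .
  qed
  have B': "pull CC f B \<in> Ob_n CC 2 G'" by (rule pull_Ob_n[OF f B])
  note A = Ob_n_2D(3)[OF B]
  note Q = P_Ob_n[OF B]
  have PA: "pull CC (pr CC (P G B)) (ft CC B) \<in> Ob_n CC 2 G"
    using Ob_n_trans[OF pull_Ob_n[OF Ob_n_1D(3)[OF Q] A] Q] by (simp add: numeral_2_eq_2)
  note e = pull_fprod[OF f Q A]
  have o: "a \<odot> proj CC B G = proj CC (pull CC (pr CC (P G B)) (ft CC B)) G"
    by (rule over[OF B Q a ap])
  have o': "a' \<odot> proj CC (pull CC f B) G' =
      proj CC (pull CC f (pull CC (pr CC (P G B)) (ft CC B))) G'"
    using over[OF B' pull_Ob_n[OF f Q], unfolded ft_pull_2[OF f B], OF a' ap'] e by simp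
  show ?thesis
    using pull_mor_qm[OF f PA B a o] pull_mor_eqI[OF f PA B a _ o'] a' e by metis
qed

lemma All_Ap2_iff:
  "Ap \<in> All_Ap2 CC (bold CC P) \<longleftrightarrow>
    Ap \<in> extensional (Ob_ge2 CC) \<and>
    (\<forall>G. \<forall>B\<in>Ob_n CC 2 G.
      Ap B \<in> hom CC (pull CC (pr CC (P G B)) (ft CC B)) B \<and>
      Ap B \<odot> pr CC B = qm CC (pr CC (P G B)) (ft CC B) \<and>
      (\<forall>G'. \<forall>f\<in>hom CC G' G.
        Ap (pull CC f B) \<odot> qm CC f B = qm CC f (pull CC (pr CC (P G B)) (ft CC B)) \<odot> Ap B) \<and>
      bij_betw (lambda_inv CC (bold CC P) Ap B) (del_fiber CC (P G B)) (del_fiber CC B))"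
  (is "_ \<longleftrightarrow> _ \<and> ?R")
proof -
  let ?h = "\<lambda>G B. Ap B \<in> hom CC (pull CC (pr CC (P G B)) (ft CC B)) B"
  let ?a = "\<lambda>G B. Ap B \<odot> pr CC B = qm CC (pr CC (P G B)) (ft CC B)"
  let ?b = "\<lambda>G B. \<forall>G'. \<forall>f\<in>hom CC G' G. pull_mor CC f (Ap B) = Ap (pull CC f B)"
  let ?c = "\<lambda>G B. bij_betw (lambda_inv CC (bold CC P) Ap B) (del_fiber CC (P G B)) (del_fiber CC B)"
  have all: "(\<forall>B\<in>Ob_ge2 CC. \<Phi> ((ft CC ^^ 2) B) B) \<longleftrightarrow> (\<forall>G. \<forall>B\<in>Ob_n CC 2 G. \<Phi> G B)" for \<Phi>
  proof
    assume "\<forall>B\<in>Ob_ge2 CC. \<Phi> ((ft CC ^^ 2) B) B"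
    then show "\<forall>G. \<forall>B\<in>Ob_n CC 2 G. \<Phi> G B" using Ob_n_2_ge2 Ob_n_2D(2) by metis
  next
    assume "\<forall>G. \<forall>B\<in>Ob_n CC 2 G. \<Phi> G B"
    then show "\<forall>B\<in>Ob_ge2 CC. \<Phi> ((ft CC ^^ 2) B) B" using Ob_ge2_iff by blast
  qed
  have fp: "fprod CC ((ft CC ^^ 2) B) (P ((ft CC ^^ 2) B) B) (ft CC B) =
      pull CC (pr CC (P ((ft CC ^^ 2) B) B)) (ft CC B)"
    "bold CC P B = P ((ft CC ^^ 2) B) B"
    if "B \<in> Ob_ge2 CC" for B
    using that by (simp_all only: Ob_ge2_iff bold_P fprod_1[OF P_Ob_n])
  have Mor: "(\<forall>f\<in>Mor CC. Cod CC f = G \<longrightarrow> \<Phi> f) \<longleftrightarrow> (\<forall>G'. \<forall>f\<in>hom CC G' G. \<Phi> f)" for G \<Phi>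
    by (auto simp: hom_def)
  have "Ap \<in> All_Ap2 CC (bold CC P) \<longleftrightarrow> Ap \<in> extensional (Ob_ge2 CC) \<and>
    (\<forall>B\<in>Ob_ge2 CC. ?h ((ft CC ^^ 2) B) B \<and> ?a ((ft CC ^^ 2) B) B \<and>
      ?b ((ft CC ^^ 2) B) B \<and> ?c ((ft CC ^^ 2) B) B)"
    unfolding All_Ap2_def PiE_def Pi_def Mor mem_Collect_eq Int_iff Ball_def[symmetric] ball_conj_distrib
    by (simp only: fp conj_ac cong: ball_cong)
  also have "\<dots> \<longleftrightarrow> Ap \<in> extensional (Ob_ge2 CC) \<and>
      (\<forall>G. \<forall>B\<in>Ob_n CC 2 G. ?h G B \<and> ?a G B \<and> ?b G B \<and> ?c G B)"
    by (simp only: all[of "\<lambda>G B. ?h G B \<and> ?a G B \<and> ?b G B \<and> ?c G B"])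
  also have "(\<forall>G. \<forall>B\<in>Ob_n CC 2 G. ?h G B \<and> ?a G B \<and> ?b G B \<and> ?c G B) \<longleftrightarrow> ?R"
  proof -
    have "pull_mor CC f (Ap B) = Ap (pull CC f B) \<longleftrightarrow>
        Ap (pull CC f B) \<odot> qm CC f B = qm CC f (pull CC (pr CC (P G B)) (ft CC B)) \<odot> Ap B"
      if ha: "\<And>G B. B \<in> Ob_n CC 2 G \<Longrightarrow> ?h G B \<and> ?a G B"
        and f: "f \<in> hom CC G' G" and B: "B \<in> Ob_n CC 2 G" for f G' G B
      using pull_Ap_iff[OF f B] ha[OF B] ha[OF pull_Ob_n[OF f B]]
      by (simp add: P_pull[OF f B] ft_pull_2[OF f B])
    note eq = this
    show ?thesis
    proof
      assume L: "\<forall>G. \<forall>B\<in>Ob_n CC 2 G. ?h G B \<and> ?a G B \<and> ?b G B \<and> ?c G B"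
      then have "?h G B \<and> ?a G B" if "B \<in> Ob_n CC 2 G" for G B using that by blast
      from eq[OF this] L show ?R by metis
    next
      assume R: ?R
      then have "?h G B \<and> ?a G B" if "B \<in> Ob_n CC 2 G" for G B using that by blast
      from eq[OF this] R show "\<forall>G. \<forall>B\<in>Ob_n CC 2 G. ?h G B \<and> ?a G B \<and> ?b G B \<and> ?c G B"
        by metis
    qed
  qed
  finally show ?thesis .
qed

lemma All_lambda2_iff:
  "lam \<in> All_lambda2 CC P \<longleftrightarrow>
    lam \<in> (\<Pi>\<^sub>E G\<in>Ob CC. \<Pi>\<^sub>E B\<in>Ob_n CC 2 G. del_fiber CC B \<rightarrow>\<^sub>E del_fiber CC (P G B)) \<and>
    (\<forall>G. \<forall>B\<in>Ob_n CC 2 G. bij_betw (lam G B) (del_fiber CC B) (del_fiber CC (P G B)) \<and>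
      (\<forall>G'. \<forall>f\<in>hom CC G' G. \<forall>s\<in>del_fiber CC B.
        pull_mor CC f (lam G B s) = lam G' (pull CC f B) (pull_mor CC f s)))"
  (is "_ \<longleftrightarrow> ?E \<and> (\<forall>G. \<forall>B\<in>_. ?bij G B \<and> (\<forall>G'. \<forall>f\<in>_. \<forall>s\<in>_. ?nat G B G' f s))")
proof -
  have "(\<forall>G\<in>Ob CC. \<forall>B\<in>Ob_n CC 2 G. ?bij G B) \<longleftrightarrow> (\<forall>G. \<forall>B\<in>Ob_n CC 2 G. ?bij G B)"
    using Ob_n_base by blast
  moreover have "(\<forall>f\<in>Mor CC. \<forall>B\<in>Ob_n CC 2 (Cod CC f). \<forall>s\<in>del_fiber CC B.
        ?nat (Cod CC f) B (Dom CC f) f s) \<longleftrightarrow>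
      (\<forall>G. \<forall>B\<in>Ob_n CC 2 G. \<forall>G'. \<forall>f\<in>hom CC G' G. \<forall>s\<in>del_fiber CC B. ?nat G B G' f s)"
    (is "?L \<longleftrightarrow> ?R")
  proof
    assume L: ?L
    show ?R
    proof (intro allI ballI)
      fix G B G' f s
      assume *: "B \<in> Ob_n CC 2 G" "f \<in> hom CC G' G" "s \<in> del_fiber CC B"
      then have "f \<in> Mor CC" "Dom CC f = G'" "Cod CC f = G" by (auto simp: hom_def)
      with L * show "?nat G B G' f s" by blast
    qed
  next
    assume ?R
    then show ?L using Mor_hom by blast
  qed
  ultimately show ?thesis unfolding All_lambda2_def mem_Collect_eq ball_conj_distrib all_conj_distrib
    by (simp only:)
qed

end

context C_system_Pi
begin

lemma P_fprod: "B \<in> Ob_n CC 2 G \<Longrightarrow>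
    P (P G B) (pull CC (pr CC (P G B)) B) = pull CC (pr CC (P G B)) (P G B)"
  by (rule P_pull[OF Ob_n_1D(3)[OF P_Ob_n]])

lemma fprod_Ob_n:
  "B \<in> Ob_n CC 2 G \<Longrightarrow> Y \<in> Ob_n CC n G \<Longrightarrow> pull CC (pr CC (P G B)) Y \<in> Ob_n CC n (P G B)"
  by (rule pull_Ob_n[OF Ob_n_1D(3)[OF P_Ob_n]])

lemma qm_pr_hom:
  "B \<in> Ob_n CC 2 G \<Longrightarrow> Y \<in> Ob_n CC n G \<Longrightarrow>
    qm CC (pr CC (P G B)) Y \<in> hom CC (pull CC (pr CC (P G B)) Y) Y"
  by (rule qm_hom[OF Ob_n_1D(3)[OF P_Ob_n]])

lemma ft_fprod:
  "B \<in> Ob_n CC 2 G \<Longrightarrow> ft CC (pull CC (pr CC (P G B)) B) = pull CC (pr CC (P G B)) (ft CC B)"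
  by (rule ft_pull_2[OF Ob_n_1D(3)[OF P_Ob_n]])

lemma P_sec_hom:
  assumes "B \<in> Ob_n CC 2 G" "s \<in> del_fiber CC (P G B)"
  shows "s \<in> hom CC G (P G B)" "s \<odot> pr CC (P G B) = Ident CC G"
  using assms(2) Ob_n_1D(2)[OF P_Ob_n[OF assms(1)]] by (auto simp: del_fiber_iff)

lemma All_lambda2_bij:
  "lam \<in> All_lambda2 CC P \<Longrightarrow> B \<in> Ob_n CC 2 G \<Longrightarrow>
    bij_betw (lam G B) (del_fiber CC B) (del_fiber CC (P G B))"
  unfolding All_lambda2_iff by blast

lemma All_lambda2_pull:
  "lam \<in> All_lambda2 CC P \<Longrightarrow> B \<in> Ob_n CC 2 G \<Longrightarrow> f \<in> hom CC G' G \<Longrightarrow> s \<in> del_fiber CC B \<Longrightarrow>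
    pull_mor CC f (lam G B s) = lam G' (pull CC f B) (pull_mor CC f s)"
  unfolding All_lambda2_iff by blast

lemma
  assumes "Ap \<in> All_Ap2 CC (bold CC P)" "B \<in> Ob_n CC 2 G"
  shows All_Ap2_hom: "Ap B \<in> hom CC (pull CC (pr CC (P G B)) (ft CC B)) B"
    and All_Ap2_qm: "f \<in> hom CC G' G \<Longrightarrow>
      Ap (pull CC f B) \<odot> qm CC f B = qm CC f (pull CC (pr CC (P G B)) (ft CC B)) \<odot> Ap B"
    and All_Ap2_bij:
      "bij_betw (lambda_inv CC (bold CC P) Ap B) (del_fiber CC (P G B)) (del_fiber CC B)"
  using assms(1)[unfolded All_Ap2_iff, THEN conjunct2, rule_format, OF assms(2)] by simp_all

section \<open>From abstraction to evaluation\<close>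

lemma C1_eq:
  assumes lam: "lam \<in> All_lambda2 CC P" and B: "B \<in> Ob_n CC 2 G"
    and e: "e \<in> del_fiber CC (pull CC (pr CC (P G B)) B)"
    and lam_e: "lam (P G B) (pull CC (pr CC (P G B)) B) e = diagonal CC G (P G B)"
  shows "C1 CC P lam B = e \<odot> qm CC (pr CC (P G B)) B"
proof -
  have "bij_betw (lam (P G B) (pull CC (pr CC (P G B)) B))
      (del_fiber CC (pull CC (pr CC (P G B)) B)) (del_fiber CC (pull CC (pr CC (P G B)) (P G B)))"
    using All_lambda2_bij[OF lam fprod_Ob_n[OF B B]] P_fprod[OF B] by simp
  then have "inv_into (del_fiber CC (pull CC (pr CC (P G B)) B))
      (lam (P G B) (pull CC (pr CC (P G B)) B)) (diagonal CC G (P G B)) = e"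
    using e lam_e bij_betw_imp_inj_on inv_into_f_f by metis
  then show ?thesis
    using Ob_n_2_ge2[OF B]
    by (simp only: C1_def restrict_apply' Let_def bold_P[OF B] Ob_n_2D(2)[OF B] fprod_1[OF P_Ob_n[OF B]])
qed

text \<open>The diagonal is a section over \<open>\<Pi>(B) \<times> \<Pi>(B) = \<Pi>(\<Pi>(B) \<times> B)\<close>, hence in the image of \<open>\<lambda>\<close>;
  its preimage \<open>e\<close> is the evaluation morphism before projecting to \<open>B\<close>.\<close>
lemma diagonal_preimage:
  assumes lam: "lam \<in> All_lambda2 CC P" and B: "B \<in> Ob_n CC 2 G"
  obtains e where "e \<in> del_fiber CC (pull CC (pr CC (P G B)) B)"
    "e \<in> hom CC (pull CC (pr CC (P G B)) (ft CC B)) (pull CC (pr CC (P G B)) B)"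
    "e \<odot> pr CC (pull CC (pr CC (P G B)) B) = Ident CC (pull CC (pr CC (P G B)) (ft CC B))"
    "lam (P G B) (pull CC (pr CC (P G B)) B) e = diagonal CC G (P G B)"
proof -
  have "diagonal CC G (P G B) \<in> del_fiber CC (P (P G B) (pull CC (pr CC (P G B)) B))"
    using diagonal_sec[OF P_Ob_n[OF B]] P_fprod[OF B] by simp
  then obtain e where e: "e \<in> del_fiber CC (pull CC (pr CC (P G B)) B)"
    "lam (P G B) (pull CC (pr CC (P G B)) B) e = diagonal CC G (P G B)"
    using bij_betw_imp_surj_on[OF All_lambda2_bij[OF lam fprod_Ob_n[OF B B]]] by (metis imageE)
  show ?thesis
  proof (rule that[OF e(1) _ _ e(2)])
    show "e \<in> hom CC (pull CC (pr CC (P G B)) (ft CC B)) (pull CC (pr CC (P G B)) B)"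
      "e \<odot> pr CC (pull CC (pr CC (P G B)) B) = Ident CC (pull CC (pr CC (P G B)) (ft CC B))"
      using e(1) unfolding del_fiber_iff ft_fprod[OF B] by simp_all
  qed
qed

text \<open>Here naturality along the section \<open>s\<close> enters. With \<open>e\<close> the section that \<open>\<lambda>\<close> sends to the
  diagonal, substituting \<open>s\<close> into the evaluation map gives \<open>s\<^sup>*(e)\<close>, and \<open>\<lambda>\<close> sends this
  to the pullback of the diagonal along \<open>s\<close>, which is \<open>s\<close>.\<close>
lemma lambda_lambda_inv_C1:
  assumes lam: "lam \<in> All_lambda2 CC P" and B: "B \<in> Ob_n CC 2 G"
    and s: "s \<in> del_fiber CC (P G B)"
  shows "lambda_inv CC (bold CC P) (C1 CC P lam) B s \<in> del_fiber CC B"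
    and "lam G B (lambda_inv CC (bold CC P) (C1 CC P lam) B s) = s"
proof -
  define Q where "Q = P G B"
  define QB where "QB = pull CC (pr CC Q) B"
  define QA where "QA = pull CC (pr CC Q) (ft CC B)"
  have Q: "Q \<in> Ob_n CC 1 G" unfolding Q_def by (rule P_Ob_n[OF B])
  have QB: "QB \<in> Ob_n CC 2 Q" unfolding QB_def Q_def by (rule fprod_Ob_n[OF B B])
  have QA: "QA \<in> Ob_n CC 1 Q" unfolding QA_def Q_def by (rule fprod_Ob_n[OF B Ob_n_2D(3)[OF B]])
  have s': "s \<in> hom CC G Q" and sQ: "s \<in> del_fiber CC Q"
    using P_sec_hom[OF B s] s by (simp_all add: Q_def)
  obtain e where e: "e \<in> del_fiber CC QB" "e \<in> hom CC QA QB" "lam Q QB e = diagonal CC G Q"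
    using diagonal_preimage[OF lam B] unfolding QA_def QB_def Q_def by metis
  have C1: "C1 CC P lam B = e \<odot> qm CC (pr CC Q) B"
    using C1_eq[OF lam B] e unfolding QB_def Q_def by blast
  note sB = pull_sec_fprod[OF Q sQ B, folded QB_def] qm_sec_fprod[OF Q sQ B, folded QB_def]
  note sA = pull_sec_fprod[OF Q sQ Ob_n_2D(3)[OF B], folded QA_def]
  have ftQB: "ft CC QB = QA" unfolding QA_def QB_def Q_def by (rule ft_fprod[OF B])
  define t where "t = pull_mor CC s e"
  have t: "t \<in> del_fiber CC B"
    using pull_sec[OF s' Ob_n_2D(5)[OF QB] e(1)] sB by (simp add: t_def)
  then have t': "t \<in> hom CC (ft CC B) B" by (simp add: del_fiber_iff)
  have tq: "t \<odot> qm CC s QB = qm CC s QA \<odot> e"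
    using pull_sec_qm[OF s' Ob_n_2D(5)[OF QB] e(1)] by (simp add: t_def ftQB)
  have q: "qm CC s QB \<in> hom CC B QB" using qm_hom[OF s' QB] sB by simp
  have qA: "qm CC s QA \<in> hom CC (ft CC B) QA" using qm_hom[OF s' QA] sA by simp
  have qQ: "qm CC (pr CC Q) B \<in> hom CC QB B" unfolding QB_def Q_def by (rule qm_pr_hom[OF B B])
  have "lambda_inv CC (bold CC P) (C1 CC P lam) B s = qm CC s QA \<odot> (e \<odot> qm CC (pr CC Q) B)"
    by (simp only: lambda_inv_eq[OF B] QA_def Q_def[symmetric] C1)
  also have "\<dots> = t \<odot> (qm CC s QB \<odot> qm CC (pr CC Q) B)"
    by (simp only: Comp_assoc[OF qA e(2) qQ, symmetric] tq[symmetric] Comp_assoc[OF t' q qQ])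
  also have "\<dots> = t" by (simp only: sB Ident_right[OF t'])
  finally have inv: "lambda_inv CC (bold CC P) (C1 CC P lam) B s = t" .
  show "lambda_inv CC (bold CC P) (C1 CC P lam) B s \<in> del_fiber CC B" using inv t by simp
  have "lam G B t = pull_mor CC s (lam Q QB e)"
    using All_lambda2_pull[OF lam QB s' e(1)] sB by (simp add: t_def)
  also have "\<dots> = s" using e(3) pull_sec_diagonal[OF Q sQ] by simp
  finally show "lam G B (lambda_inv CC (bold CC P) (C1 CC P lam) B s) = s" using inv by simp
qed

lemma lambda_inv_C1_lambda:
  assumes lam: "lam \<in> All_lambda2 CC P" and B: "B \<in> Ob_n CC 2 G" and t: "t \<in> del_fiber CC B"
  shows "lambda_inv CC (bold CC P) (C1 CC P lam) B (lam G B t) = t"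
proof -
  note bij = All_lambda2_bij[OF lam B]
  have "lam G B t \<in> del_fiber CC (P G B)" using bij t by (rule bij_betwE[rule_format])
  from lambda_lambda_inv_C1[OF lam B this] show ?thesis
    using bij_betw_imp_inj_on[OF bij] t by (auto dest: inj_onD)
qed

lemma lambda_inv_C1_bij:
  assumes lam: "lam \<in> All_lambda2 CC P" and B: "B \<in> Ob_n CC 2 G"
  shows "bij_betw (lambda_inv CC (bold CC P) (C1 CC P lam) B) (del_fiber CC (P G B)) (del_fiber CC B)"
proof (rule bij_betw_byWitness[where f' = "lam G B"])
  show "\<forall>s\<in>del_fiber CC (P G B). lam G B (lambda_inv CC (bold CC P) (C1 CC P lam) B s) = s"
    using lambda_lambda_inv_C1[OF lam B] by blast
  show "\<forall>t\<in>del_fiber CC B. lambda_inv CC (bold CC P) (C1 CC P lam) B (lam G B t) = t"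
    using lambda_inv_C1_lambda[OF lam B] by blast
  show "lambda_inv CC (bold CC P) (C1 CC P lam) B ` del_fiber CC (P G B) \<subseteq> del_fiber CC B"
    using lambda_lambda_inv_C1[OF lam B] by blast
  show "lam G B ` del_fiber CC B \<subseteq> del_fiber CC (P G B)"
    using All_lambda2_bij[OF lam B] by (simp add: bij_betw_def)
qed

text \<open>Stability of the evaluation maps is naturality of \<open>\<lambda>\<close> along \<open>h = q(f, \<Pi>(B))\<close>: the
  diagonal pulls back to the diagonal along \<open>h\<close>, hence so does its preimage \<open>e\<close>.\<close>
lemma C1_qm:
  assumes lam: "lam \<in> All_lambda2 CC P" and B: "B \<in> Ob_n CC 2 G" and f: "f \<in> hom CC G' G"
  shows "C1 CC P lam (pull CC f B) \<odot> qm CC f B =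
    qm CC f (pull CC (pr CC (P G B)) (ft CC B)) \<odot> C1 CC P lam B"
proof -
  define Q where "Q = P G B"
  define QB where "QB = pull CC (pr CC Q) B"
  define QA where "QA = pull CC (pr CC Q) (ft CC B)"
  define B' where "B' = pull CC f B"
  define Q' where "Q' = pull CC f Q"
  define h where "h = qm CC f Q"
  have Q: "Q \<in> Ob_n CC 1 G" unfolding Q_def by (rule P_Ob_n[OF B])
  have QB: "QB \<in> Ob_n CC 2 Q" unfolding QB_def Q_def by (rule fprod_Ob_n[OF B B])
  have QA: "QA \<in> Ob_n CC 1 Q" unfolding QA_def Q_def by (rule fprod_Ob_n[OF B Ob_n_2D(3)[OF B]])
  have B': "B' \<in> Ob_n CC 2 G'" unfolding B'_def by (rule pull_Ob_n[OF f B])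
  have PB': "P G' B' = Q'" unfolding B'_def Q'_def Q_def by (rule P_pull[OF f B])
  have h: "h \<in> hom CC Q' Q" unfolding h_def Q'_def by (rule qm_hom[OF f Q])
  obtain e where e: "e \<in> del_fiber CC QB" "e \<in> hom CC QA QB" "lam Q QB e = diagonal CC G Q"
    using diagonal_preimage[OF lam B] unfolding QA_def QB_def Q_def by metis
  have C1: "C1 CC P lam B = e \<odot> qm CC (pr CC Q) B"
    using C1_eq[OF lam B] e unfolding QB_def Q_def by blast
  have ftQB: "ft CC QB = QA" unfolding QA_def QB_def Q_def by (rule ft_fprod[OF B])
  have hQB: "pull CC h QB = pull CC (pr CC Q') B'"
    using pull_stage[OF f Q QB] pull_fprod[OF f Q B] by (simp add: h_def QB_def Q'_def B'_def)
  have qhQB: "qm CC h QB \<odot> qm CC (pr CC Q) B = qm CC (pr CC Q') B' \<odot> qm CC f B"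
    using qm_stage[OF f Q QB] qm_fprod[OF f Q B] by (simp add: h_def QB_def Q'_def B'_def)
  have qhQA: "qm CC h QA = qm CC f QA" unfolding h_def by (rule qm_stage[OF f Q QA])
  define e' where "e' = pull_mor CC h e"
  have e's: "e' \<in> del_fiber CC (pull CC (pr CC Q') B')"
    using pull_sec[OF h Ob_n_2D(5)[OF QB] e(1)] hQB by (simp add: e'_def)
  have e'q: "e' \<odot> qm CC h QB = qm CC h QA \<odot> e"
    using pull_sec_qm[OF h Ob_n_2D(5)[OF QB] e(1)] by (simp add: e'_def ftQB)
  have "lam Q' (pull CC (pr CC Q') B') e' = pull_mor CC h (lam Q QB e)"
    using All_lambda2_pull[OF lam QB h e(1)] hQB by (simp add: e'_def)
  also have "\<dots> = diagonal CC G' Q'"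
    using e(3) pull_qm_diagonal[OF f Q] by (simp add: h_def Q'_def)
  finally have "lam Q' (pull CC (pr CC Q') B') e' = diagonal CC G' Q'" .
  then have C1': "C1 CC P lam B' = e' \<odot> qm CC (pr CC Q') B'"
    using C1_eq[OF lam B', unfolded PB', OF e's] by blast
  have e'h: "e' \<in> hom CC (pull CC (pr CC Q') (ft CC B')) (pull CC (pr CC Q') B')"
    using e's ft_fprod[OF B', unfolded PB'] by (simp add: del_fiber_iff)
  have qB: "qm CC f B \<in> hom CC B' B" unfolding B'_def by (rule qm_hom[OF f B])
  have qQ: "qm CC (pr CC Q) B \<in> hom CC QB B" unfolding QB_def Q_def by (rule qm_pr_hom[OF B B])
  have qQ': "qm CC (pr CC Q') B' \<in> hom CC (pull CC (pr CC Q') B') B'"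
    by (rule qm_pr_hom[OF B' B', unfolded PB'])
  have qh: "qm CC h QB \<in> hom CC (pull CC (pr CC Q') B') QB" using qm_hom[OF h QB] hQB by simp
  have "C1 CC P lam B' \<odot> qm CC f B = e' \<odot> qm CC h QB \<odot> qm CC (pr CC Q) B"
    by (simp only: C1' Comp_assoc[OF e'h qQ' qB] Comp_assoc[OF e'h qh qQ] qhQB)
  also have "\<dots> = qm CC h QA \<odot> C1 CC P lam B"
    by (simp only: e'q C1 Comp_assoc[OF qm_hom[OF h QA] e(2) qQ])
  finally show ?thesis unfolding qhQA unfolding B'_def QA_def Q_def .
qed

lemma C1_All_Ap2:
  assumes lam: "lam \<in> All_lambda2 CC P"
  shows "C1 CC P lam \<in> All_Ap2 CC (bold CC P)"
  unfolding All_Ap2_iff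
proof (intro conjI allI ballI)
  show "C1 CC P lam \<in> extensional (Ob_ge2 CC)" by (simp add: C1_def)
next
  fix G B assume B: "B \<in> Ob_n CC 2 G"
  note p = Ob_n_1D(3)[OF P_Ob_n[OF B]]
  obtain e where e: "e \<in> del_fiber CC (pull CC (pr CC (P G B)) B)"
    "e \<in> hom CC (pull CC (pr CC (P G B)) (ft CC B)) (pull CC (pr CC (P G B)) B)"
    "e \<odot> pr CC (pull CC (pr CC (P G B)) B) = Ident CC (pull CC (pr CC (P G B)) (ft CC B))"
    "lam (P G B) (pull CC (pr CC (P G B)) B) e = diagonal CC G (P G B)"
    using diagonal_preimage[OF lam B] by blast
  note C1 = C1_eq[OF lam B e(1,4)]
  note q = qm_pr_hom[OF B B] and qA = qm_pr_hom[OF B Ob_n_2D(3)[OF B]]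
  show "C1 CC P lam B \<in> hom CC (pull CC (pr CC (P G B)) (ft CC B)) B"
    unfolding C1 by (rule Comp_hom[OF e(2) q])
  show "C1 CC P lam B \<odot> pr CC B = qm CC (pr CC (P G B)) (ft CC B)"
    using Comp_assoc[OF e(2) q pr_hom[OF Ob_n_2D(1)[OF B]]] pr_qm[OF p Ob_n_2D(5)[OF B]]
      Comp_assoc[OF e(2) pr_hom_pull[OF p Ob_n_2D(5)[OF B]] qA] e(3) Ident_left[OF qA]
    by (simp add: C1)
  show "bij_betw (lambda_inv CC (bold CC P) (C1 CC P lam) B) (del_fiber CC (P G B)) (del_fiber CC B)"
    by (rule lambda_inv_C1_bij[OF lam B])
next
  fix G B G' f assume "B \<in> Ob_n CC 2 G" "f \<in> hom CC G' G"
  then show "C1 CC P lam (pull CC f B) \<odot> qm CC f B =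
      qm CC f (pull CC (pr CC (P G B)) (ft CC B)) \<odot> C1 CC P lam B"
    by (rule C1_qm[OF lam])
qed

section \<open>From evaluation to abstraction\<close>

text \<open>The square for \<open>Ap\<close> reduces the claim to \<open>q(f\<^sup>*(s), \<Pi>(B') \<times> A') \<odot> q(f, \<Pi>(B) \<times> A) =
  q(f, A) \<odot> q(s, \<Pi>(B) \<times> A)\<close>: functoriality of \<open>q\<close> applied to the two sides of
  \<open>f\<^sup>*(s) \<odot> q(f, \<Pi>(B)) = f \<odot> s\<close>.\<close>
lemma lambda_inv_pull:
  assumes Ap: "Ap \<in> All_Ap2 CC (bold CC P)" and B: "B \<in> Ob_n CC 2 G" and f: "f \<in> hom CC G' G"
    and s: "s \<in> del_fiber CC (P G B)"
  shows "pull_mor CC f (lambda_inv CC (bold CC P) Ap B s) =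
    lambda_inv CC (bold CC P) Ap (pull CC f B) (pull_mor CC f s)"
proof -
  define Q where "Q = P G B"
  define A where "A = ft CC B"
  define QA where "QA = pull CC (pr CC Q) A"
  define B' where "B' = pull CC f B"
  define Q' where "Q' = pull CC f Q"
  define h where "h = qm CC f Q"
  define s' where "s' = pull_mor CC f s"
  define A' where "A' = pull CC f A"
  define QA' where "QA' = pull CC (pr CC Q') A'"
  let ?l = "lambda_inv CC (bold CC P) Ap"
  have Q: "Q \<in> Ob_n CC 1 G" unfolding Q_def by (rule P_Ob_n[OF B])
  have A: "A \<in> Ob_n CC 1 G" unfolding A_def by (rule Ob_n_2D(3)[OF B])
  have QA: "QA \<in> Ob_n CC 1 Q" unfolding QA_def by (rule pull_Ob_n[OF Ob_n_1D(3)[OF Q] A])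
  have B': "B' \<in> Ob_n CC 2 G'" unfolding B'_def by (rule pull_Ob_n[OF f B])
  have ftB': "ft CC B' = A'" unfolding B'_def A'_def A_def by (rule ft_pull_2[OF f B])
  have PB': "P G' B' = Q'" unfolding B'_def Q'_def Q_def by (rule P_pull[OF f B])
  have Q': "Q' \<in> Ob_n CC 1 G'" unfolding Q'_def by (rule pull_Ob_n[OF f Q])
  have A': "A' \<in> Ob_n CC 1 G'" unfolding A'_def by (rule pull_Ob_n[OF f A])
  have QA': "QA' \<in> Ob_n CC 1 Q'" unfolding QA'_def by (rule pull_Ob_n[OF Ob_n_1D(3)[OF Q'] A'])
  have h: "h \<in> hom CC Q' Q" unfolding h_def Q'_def by (rule qm_hom[OF f Q])
  have sQ: "s \<in> del_fiber CC Q" "s \<in> hom CC G Q" using P_sec_hom[OF B s] s by (simp_all add: Q_def)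
  have s'Q: "s' \<in> del_fiber CC Q'" using pull_sec[OF f Ob_n_1D(4)[OF Q] sQ(1)] by (simp add: s'_def Q'_def)
  then have s'h: "s' \<in> hom CC G' Q'" using Ob_n_1D(2)[OF Q'] by (simp add: del_fiber_iff)
  have s'e: "s' \<odot> h = f \<odot> s"
    using pull_sec_qm[OF f Ob_n_1D(4)[OF Q] sQ(1)] Ob_n_1D(2)[OF Q] qm_0[OF f]
    by (simp add: s'_def h_def)
  note sA = pull_sec_fprod[OF Q sQ(1) A, folded QA_def]
  note s'A = pull_sec_fprod[OF Q' s'Q A', folded QA'_def]
  have hQA: "pull CC h QA = QA'"
    using pull_stage[OF f Q QA] pull_fprod[OF f Q A] by (simp add: h_def QA_def QA'_def Q'_def A'_def)
  have qhQA: "qm CC h QA = qm CC f QA" unfolding h_def by (rule qm_stage[OF f Q QA])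
  have square: "qm CC s' QA' \<odot> qm CC f QA = qm CC f A \<odot> qm CC s QA"
    using qm_Comp[OF s'h h QA] qm_Comp[OF f sQ(2) QA] by (simp add: s'e hQA qhQA sA)
  have a: "Ap B \<in> hom CC QA B" unfolding QA_def Q_def A_def by (rule All_Ap2_hom[OF Ap B])
  have a': "Ap B' \<in> hom CC QA' B'" unfolding QA'_def using All_Ap2_hom[OF Ap B'] PB' ftB' by simp
  have aq: "Ap B' \<odot> qm CC f B = qm CC f QA \<odot> Ap B"
    unfolding QA_def Q_def A_def B'_def by (rule All_Ap2_qm[OF Ap B f])
  have l: "?l B s = qm CC s QA \<odot> Ap B" "?l B' s' = qm CC s' QA' \<odot> Ap B'"
    unfolding lambda_inv_eq[OF B] lambda_inv_eq[OF B'] by (simp_all only: QA_def Q_def A_def QA'_def PB' ftB')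
  have "?l B s \<in> del_fiber CC B" using All_Ap2_bij[OF Ap B] s by (rule bij_betwE[rule_format])
  moreover have "?l B' s' \<in> del_fiber CC B'"
    using All_Ap2_bij[OF Ap B'] s'Q PB' by (metis bij_betwE)
  moreover have "?l B' s' \<odot> qm CC f B = qm CC f (ft CC B) \<odot> ?l B s"
  proof -
    have qf: "qm CC f B \<in> hom CC B' B" unfolding B'_def by (rule qm_hom[OF f B])
    have qs': "qm CC s' QA' \<in> hom CC A' QA'" using qm_hom[OF s'h QA'] s'A by simp
    have qs: "qm CC s QA \<in> hom CC A QA" using qm_hom[OF sQ(2) QA] sA by simp
    have qfA: "qm CC f A \<in> hom CC A' A" unfolding A'_def by (rule qm_hom[OF f A])
    have qfQA: "qm CC f QA \<in> hom CC QA' QA" using qm_hom[OF h QA] by (simp add: hQA qhQA)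
    have "?l B' s' \<odot> qm CC f B = qm CC s' QA' \<odot> qm CC f QA \<odot> Ap B"
      by (simp only: l Comp_assoc[OF qs' a' qf] aq Comp_assoc[OF qs' qfQA a])
    also have "\<dots> = qm CC f A \<odot> ?l B s" by (simp only: square l Comp_assoc[OF qfA qs a])
    finally show ?thesis by (simp only: A_def)
  qed
  ultimately show ?thesis
    unfolding s'_def[symmetric] B'_def[symmetric]
    using pull_sec_eqI[OF f Ob_n_2D(5)[OF B], folded B'_def] by blast
qed

lemma C2_apply:
  "B \<in> Ob_n CC 2 G \<Longrightarrow> t \<in> del_fiber CC B \<Longrightarrow>
    C2 CC P Ap G B t = inv_into (del_fiber CC (P G B)) (lambda_inv CC (bold CC P) Ap B) t"
  using Ob_n_base by (simp add: C2_def bold_P)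

lemma C2_eqI:
  assumes Ap: "Ap \<in> All_Ap2 CC (bold CC P)" and B: "B \<in> Ob_n CC 2 G"
    and s: "s \<in> del_fiber CC (P G B)"
  shows "C2 CC P Ap G B (lambda_inv CC (bold CC P) Ap B s) = s"
proof -
  note bij = All_Ap2_bij[OF Ap B]
  have "lambda_inv CC (bold CC P) Ap B s \<in> del_fiber CC B" using bij s by (rule bij_betwE[rule_format])
  then show ?thesis
    using inv_into_f_f[OF bij_betw_imp_inj_on[OF bij] s] by (simp only: C2_apply[OF B])
qed

lemma C2_bij:
  assumes Ap: "Ap \<in> All_Ap2 CC (bold CC P)" and B: "B \<in> Ob_n CC 2 G"
  shows "bij_betw (C2 CC P Ap G B) (del_fiber CC B) (del_fiber CC (P G B))"
  using bij_betw_inv_into[OF All_Ap2_bij[OF Ap B]] C2_apply[OF B]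
  by (subst bij_betw_cong) auto

lemma C2_All_lambda2:
  assumes Ap: "Ap \<in> All_Ap2 CC (bold CC P)"
  shows "C2 CC P Ap \<in> All_lambda2 CC P"
  unfolding All_lambda2_iff
proof (intro conjI allI ballI)
  show "C2 CC P Ap \<in> (\<Pi>\<^sub>E G\<in>Ob CC. \<Pi>\<^sub>E B\<in>Ob_n CC 2 G. del_fiber CC B \<rightarrow>\<^sub>E del_fiber CC (P G B))"
  proof (intro PiE_I)
    fix G B t assume "B \<in> Ob_n CC 2 G" "t \<in> del_fiber CC B"
    then show "C2 CC P Ap G B t \<in> del_fiber CC (P G B)"
      using bij_betwE[OF C2_bij[OF Ap]] by blast
  qed (simp_all add: C2_def)
next
  fix G B assume "B \<in> Ob_n CC 2 G"
  then show "bij_betw (C2 CC P Ap G B) (del_fiber CC B) (del_fiber CC (P G B))"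
    by (rule C2_bij[OF Ap])
next
  fix G B G' f t
  assume B: "B \<in> Ob_n CC 2 G" and f: "f \<in> hom CC G' G" and t: "t \<in> del_fiber CC B"
  have "t \<in> lambda_inv CC (bold CC P) Ap B ` del_fiber CC (P G B)"
    using All_Ap2_bij[OF Ap B] t by (simp add: bij_betw_def)
  then obtain s where s: "s \<in> del_fiber CC (P G B)" "t = lambda_inv CC (bold CC P) Ap B s" by blast
  have "pull_mor CC f s \<in> del_fiber CC (P G' (pull CC f B))"
    using pull_sec[OF f Ob_n_1D(4)[OF P_Ob_n[OF B]] s(1)] P_pull[OF f B] by simp
  then show "pull_mor CC f (C2 CC P Ap G B t) = C2 CC P Ap G' (pull CC f B) (pull_mor CC f t)"
    by (simp only: s(2) C2_eqI[OF Ap B s(1)] lambda_inv_pull[OF Ap B f s(1)]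
        C2_eqI[OF Ap pull_Ob_n[OF f B]])
qed

section \<open>The two constructions are mutually inverse\<close>

lemma C2_C1:
  assumes lam: "lam \<in> All_lambda2 CC P"
  shows "C2 CC P (C1 CC P lam) = lam"
proof -
  let ?F = "\<Pi>\<^sub>E G\<in>Ob CC. \<Pi>\<^sub>E B\<in>Ob_n CC 2 G. del_fiber CC B \<rightarrow>\<^sub>E del_fiber CC (P G B)"
  have l: "lam \<in> ?F" and c: "C2 CC P (C1 CC P lam) \<in> ?F"
    using lam C2_All_lambda2[OF C1_All_Ap2[OF lam]] unfolding All_lambda2_iff by simp_all
  show ?thesis
  proof (rule PiE_ext[OF c l])
    fix G assume G: "G \<in> Ob CC"
    show "C2 CC P (C1 CC P lam) G = lam G"
    proof (rule PiE_ext[OF PiE_mem[OF c G] PiE_mem[OF l G]])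
      fix B assume B: "B \<in> Ob_n CC 2 G"
      show "C2 CC P (C1 CC P lam) G B = lam G B"
      proof (rule PiE_ext[OF PiE_mem[OF PiE_mem[OF c G] B] PiE_mem[OF PiE_mem[OF l G] B]])
        fix t assume t: "t \<in> del_fiber CC B"
        then have "lam G B t \<in> del_fiber CC (P G B)"
          using bij_betwE[OF All_lambda2_bij[OF lam B]] by blast
        from C2_eqI[OF C1_All_Ap2[OF lam] B this]
        show "C2 CC P (C1 CC P lam) G B t = lam G B t"
          by (simp only: lambda_inv_C1_lambda[OF lam B t])
      qed
    qed
  qed
qed

text \<open>The section that the new \<open>\<lambda>\<close> sends to the diagonal \<open>\<delta>\<close> is \<open>\<lambda>inv(\<delta>)\<close> by definition.
  Stability moves the projection \<open>q(p, B)\<close> in front of \<open>Ap\<close>, where it composes with \<open>\<delta>\<close> to an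
  identity.\<close>
lemma C1_C2:
  assumes Ap: "Ap \<in> All_Ap2 CC (bold CC P)"
  shows "C1 CC P (C2 CC P Ap) = Ap"
proof (rule extensionalityI)
  show "C1 CC P (C2 CC P Ap) \<in> extensional (Ob_ge2 CC)" by (simp add: C1_def)
  show "Ap \<in> extensional (Ob_ge2 CC)" using Ap by (simp add: All_Ap2_iff)
next
  fix B assume "B \<in> Ob_ge2 CC"
  then obtain G where B: "B \<in> Ob_n CC 2 G" using Ob_ge2_iff by blast
  define Q where "Q = P G B"
  define A where "A = ft CC B"
  define QB where "QB = pull CC (pr CC Q) B"
  define QA where "QA = pull CC (pr CC Q) A"
  define QQ where "QQ = pull CC (pr CC Q) Q"
  define QQA where "QQA = pull CC (pr CC QQ) QA"
  define d where "d = diagonal CC G Q"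
  define e where "e = lambda_inv CC (bold CC P) Ap QB d"
  have Q: "Q \<in> Ob_n CC 1 G" unfolding Q_def by (rule P_Ob_n[OF B])
  have A: "A \<in> Ob_n CC 1 G" unfolding A_def by (rule Ob_n_2D(3)[OF B])
  note p = Ob_n_1D(3)[OF Q]
  have QA: "QA \<in> Ob_n CC 1 Q" unfolding QA_def by (rule pull_Ob_n[OF p A])
  have QB: "QB \<in> Ob_n CC 2 Q" unfolding QB_def by (rule pull_Ob_n[OF p B])
  have QQ: "QQ \<in> Ob_n CC 1 Q" unfolding QQ_def by (rule fprod_self_Ob_n[OF Q])
  have QQA: "QQA \<in> Ob_n CC 1 QQ" unfolding QQA_def by (rule pull_Ob_n[OF Ob_n_1D(3)[OF QQ] QA])
  have PQB: "P Q QB = QQ" unfolding QB_def QQ_def Q_def by (rule P_fprod[OF B])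
  have ftQB: "ft CC QB = QA" unfolding QB_def QA_def A_def Q_def by (rule ft_fprod[OF B])
  have d: "d \<in> del_fiber CC QQ" "d \<in> hom CC Q QQ" "d \<odot> qm CC (pr CC Q) Q = Ident CC Q"
    using diagonal_sec[OF Q] diagonal_hom[OF Q] diagonal_qm[OF Q] by (simp_all add: d_def QQ_def)
  have dP: "d \<in> del_fiber CC (P Q QB)" using d(1) PQB by simp
  have e: "e \<in> del_fiber CC QB" unfolding e_def
    using bij_betwE[OF All_Ap2_bij[OF Ap QB]] dP by blast
  have "C2 CC P Ap Q QB e = d" unfolding e_def by (rule C2_eqI[OF Ap QB dP])
  then have C1: "C1 CC P (C2 CC P Ap) B = e \<odot> qm CC (pr CC Q) B"
    using C1_eq[OF C2_All_lambda2[OF Ap] B] e unfolding QB_def Q_def d_def by blast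
  have a: "Ap B \<in> hom CC QA B" unfolding QA_def Q_def A_def by (rule All_Ap2_hom[OF Ap B])
  have aQ: "Ap QB \<in> hom CC QQA QB" unfolding QQA_def using All_Ap2_hom[OF Ap QB] PQB ftQB by simp
  have aq: "Ap QB \<odot> qm CC (pr CC Q) B = qm CC (pr CC Q) QA \<odot> Ap B"
    unfolding QB_def using All_Ap2_qm[OF Ap B p] by (simp only: QA_def Q_def A_def)
  have e_eq: "e = qm CC d QQA \<odot> Ap QB"
    unfolding e_def lambda_inv_eq[OF QB] by (simp only: PQB ftQB QQA_def)
  note q = qm_hom[OF p Q, folded QQ_def]
  have qQA: "pull CC (qm CC (pr CC Q) Q) QA = QQA"
    using pull_stage[OF p Q QA] pull_fprod[OF p Q A]
    by (simp add: QQA_def QQ_def QA_def)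
  have qqQA: "qm CC (qm CC (pr CC Q) Q) QA = qm CC (pr CC Q) QA" by (rule qm_stage[OF p Q QA])
  have "pull CC d QQA = QA" using pull_sec_fprod[OF QQ d(1) QA] by (simp add: QQA_def)
  then have qd: "qm CC d QQA \<in> hom CC QA QQA" using qm_hom[OF d(2) QQA] by simp
  have qp: "qm CC (pr CC Q) QA \<in> hom CC QQA QA"
    using qm_hom[OF q QA] by (simp add: qQA qqQA)
  have unit: "qm CC d QQA \<odot> qm CC (pr CC Q) QA = Ident CC QA"
    using qm_Comp[OF d(2) q QA] qm_Ident[OF QA] by (simp add: d(3) qQA qqQA)
  have qB: "qm CC (pr CC Q) B \<in> hom CC QB B" unfolding QB_def by (rule qm_hom[OF p B])
  have "C1 CC P (C2 CC P Ap) B = qm CC d QQA \<odot> qm CC (pr CC Q) QA \<odot> Ap B"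
    by (simp only: C1 e_eq Comp_assoc[OF qd aQ qB] aq Comp_assoc[OF qd qp a])
  also have "\<dots> = Ap B" by (simp only: unit Ident_left[OF a])
  finally show "C1 CC P (C2 CC P Ap) B = Ap B" .
qed

lemma diagonal_well_defined:
  assumes "B \<in> Ob_ge2 CC" "G = (ft CC ^^ 2) B" "Q = bold CC P B" "QB = fprod CC G Q B"
  shows "Q \<in> Ob CC \<and> QB \<in> Ob_n CC 2 Q \<and> fprod CC G Q Q = bold CC P QB \<and>
    (\<exists>!d. is_diagonal CC G Q d) \<and> diagonal CC G Q \<in> del_fiber CC (P Q QB)"
proof -
  have B: "B \<in> Ob_n CC 2 G" using assms(1,2) Ob_ge2_iff by blast
  have Q: "Q = P G B" unfolding assms(3) by (rule bold_P[OF B])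
  have Q1: "Q \<in> Ob_n CC 1 G" unfolding Q by (rule P_Ob_n[OF B])
  have QB: "QB = pull CC (pr CC Q) B" unfolding assms(4) by (rule fprod_1[OF Q1])
  have QB2: "QB \<in> Ob_n CC 2 Q" unfolding QB by (rule pull_Ob_n[OF Ob_n_1D(3)[OF Q1] B])
  have PQ: "P Q QB = pull CC (pr CC Q) Q" unfolding QB unfolding Q by (rule P_fprod[OF B])
  have "fprod CC G Q Q = bold CC P QB" by (simp only: bold_P[OF QB2] PQ fprod_1[OF Q1])
  with Ob_n_1D(1)[OF Q1] QB2 diagonal_ex1[OF Q1] diagonal_sec[OF Q1] show ?thesis
    by (simp only: PQ simp_thms)
qed

end

section \<open>The bijection\<close>

theorem mainTheorem4:
  fixes CC :: "('o, 'm) csys"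
    and P :: "'o \<Rightarrow> 'o \<Rightarrow> 'o"
  assumes "C_system CC"
    and "presheaf_morphism CC (Ob_n CC 2) (pull CC) (Ob_n CC 1) (pull CC) P"
  shows "(\<forall>B\<in>Ob_ge2 CC. \<forall>G Q QB. G = (ft CC ^^ 2) B \<and> Q = bold CC P B \<and> QB = fprod CC G Q B \<longrightarrow>
            Q \<in> Ob CC \<and> QB \<in> Ob_n CC 2 Q \<and> fprod CC G Q Q = bold CC P QB \<and>
            (\<exists>!d. is_diagonal CC G Q d) \<and> diagonal CC G Q \<in> del_fiber CC (P Q QB))
       \<and> C1 CC P \<in> All_lambda2 CC P \<rightarrow> All_Ap2 CC (bold CC P)
       \<and> C2 CC P \<in> All_Ap2 CC (bold CC P) \<rightarrow> All_lambda2 CC P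
       \<and> (\<forall>lam\<in>All_lambda2 CC P. C2 CC P (C1 CC P lam) = lam)
       \<and> (\<forall>Ap\<in>All_Ap2 CC (bold CC P). C1 CC P (C2 CC P Ap) = Ap)
       \<and> bij_betw (C1 CC P) (All_lambda2 CC P) (All_Ap2 CC (bold CC P))"
proof -
  interpret C_system_Pi CC P
    using assms by (intro C_system_Pi.intro C_system_Pi_axioms.intro)
  show ?thesis
  proof (intro conjI)
    show "\<forall>B\<in>Ob_ge2 CC. \<forall>G Q QB. G = (ft CC ^^ 2) B \<and> Q = bold CC P B \<and> QB = fprod CC G Q B \<longrightarrow>
        Q \<in> Ob CC \<and> QB \<in> Ob_n CC 2 Q \<and> fprod CC G Q Q = bold CC P QB \<and>
        (\<exists>!d. is_diagonal CC G Q d) \<and> diagonal CC G Q \<in> del_fiber CC (P Q QB)"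
      using diagonal_well_defined by blast
    show "bij_betw (C1 CC P) (All_lambda2 CC P) (All_Ap2 CC (bold CC P))"
      by (rule bij_betw_byWitness[where f' = "C2 CC P"])
        (auto simp: C1_C2 C2_C1 C1_All_Ap2 C2_All_lambda2)
  qed (auto simp: C1_C2 C2_C1 C1_All_Ap2 C2_All_lambda2)
qed

end
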